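(* Let $f_{xxx}$ be a ternary cubic form over $\mathbb{C}$. The following are equivalent: (1) $S=0$ and $T\neq 0$. (2) $f_{xxx}=a_x^3+b_x^3+c_x^3$ for some linearly independent linear forms $a_x,b_x,c_x$. Moreover, when these conditions hold, $\operatorname{rank}[f_{xxx}]=3$.
   Context: All forms are homogeneous polynomials with complex coefficients in $x_1,x_2,x_3$ (the zero polynomial is allowed); subscripts indicate degree, so $a_x=a_1x_1+a_2x_2+a_3x_3$ is a linear form and $f_{xxx}$ a cubic form. Let $u_1,u_2,u_3$ be further independent variables and $u_x=u_1x_1+u_2x_2+u_3x_3$. Rank: for a form $f$ of degree $d$, $\operatorname{rank}[f]$ (Waring rank) is the smallest integer $r\ge 0$ such that $f$ is a sum of $r$ $d$-th powers of linear forms in $\mathbb{C}[x_1,x_2,x_3]$. Transvectants: for forms $f,g,h$ in $x_1,x_2,x_3$ (whose coefficients may be polynomials in $u_1,u_2,u_3$, treated as constants), $\mathcal{J}_n[f,g,h]$ is obtained by applying $\Omega^n$ to $f(x)g(y)h(z)$, where $x,y,z$ are three independent triples of variables and $\Omega$ is the differential operator given by the $3\times 3$ determinant with rows $(\partial/\partial x_i)_i$, $(\partial/\partial y_i)_i$, $(\partial/\partial z_i)_i$, and then setting $y=z=x$. Concomitants of $f_{xxx}$: the Hessian $\Delta_{xxx}=\frac1{12}\mathcal{J}_2[f_{xxx},f_{xxx},f_{xxx}]$; $S_{uuu}=\frac1{576}\mathcal{J}_4[f_{xxx}u_x,f_{xxx}u_x,f_{xxx}u_x]$ and $T_{uuu}=\frac1{576}\mathcal{J}_4[f_{xxx}u_x,f_{xxx}u_x,\Delta_{xxx}u_x]$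 (cubic forms in $u_1,u_2,u_3$). The Aronhold invariants $S,T\in\mathbb{C}$ are obtained from $S_{uuu}$ and $T_{uuu}$, respectively, by the substitution $u^3\mapsto f$ replacing the coefficients of $u_x^3$ by the corresponding coefficients of $f_{xxx}$: i.e. the linear substitution on cubic monomials in $u$ sending $\frac{3!}{i!\,j!\,k!}u_1^iu_2^ju_3^k$ ($i+j+k=3$) to the coefficient of $x_1^ix_2^jx_3^k$ in $f_{xxx}$. *)

theory Defs
  imports Complex_Main "HOL-Library.Poly_Mapping" "HOL-Library.Numeral_Type"
begin

section \<open>Polynomials in finitely many variables\<close>

text \<open>
  A polynomial over \<open>'c\<close> in the variables \<open>'v\<close> is a finitely supported map from monomials
  (exponent vectors) to coefficients; the ring operations are those of \<^theory>\<open>HOL-Library.Poly_Mapping\<close>.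
  In a ternary polynomial the variables are indexed by the three-element type \<open>3\<close>, whose elements
  are \<open>1\<close>, \<open>2\<close> and \<open>3 = 0\<close>.
\<close>

type_synonym ('v, 'c) mpoly = "('v \<Rightarrow>\<^sub>0 nat) \<Rightarrow>\<^sub>0 'c"
type_synonym 'c tpoly = "(3, 'c) mpoly"

definition const :: "'c::zero \<Rightarrow> ('v, 'c) mpoly" where
  "const c = Poly_Mapping.single 0 c"

definition var :: "'v \<Rightarrow> ('v, 'c::zero_neq_one) mpoly" where
  "var v = Poly_Mapping.single (Poly_Mapping.single v 1) 1"

definition pd :: "'v \<Rightarrow> ('v, 'c::comm_ring_1) mpoly \<Rightarrow> ('v, 'c) mpoly" where
  "pd v p = (\<Sum>m \<in> Poly_Mapping.keys p.
     Poly_Mapping.single (m - Poly_Mapping.single v 1)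
       (of_nat (Poly_Mapping.lookup m v) * Poly_Mapping.lookup p m))"

text \<open>The substitution replacing each variable \<open>v\<close> by the variable \<open>r v\<close>; \<open>r\<close> need not be injective.\<close>

definition rename :: "('v \<Rightarrow> 'w) \<Rightarrow> ('v, 'c::comm_ring_1) mpoly \<Rightarrow> ('w, 'c) mpoly" where
  "rename r p = (\<Sum>m \<in> Poly_Mapping.keys p.
     Poly_Mapping.single
       (\<Sum>v \<in> Poly_Mapping.keys m. Poly_Mapping.single (r v) (Poly_Mapping.lookup m v))
       (Poly_Mapping.lookup p m))"


section \<open>Ternary forms\<close>

definition is_form :: "nat \<Rightarrow> 'c::zero tpoly \<Rightarrow> bool" where
  "is_form d f \<longleftrightarrow>
     (\<forall>m \<in> Poly_Mapping.keys f. (\<Sum>i\<in>UNIV. Poly_Mapping.lookup m i) = d)"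

global_interpretation tpoly: vector_space "\<lambda>(c::complex) (p::complex tpoly). const c * p"
  by unfold_locales
    (simp_all add: const_def algebra_simps single_add mult_single flip: mult.assoc)

text \<open>The degree is a parameter because the zero polynomial is a form of every degree.\<close>

definition waring_rank :: "nat \<Rightarrow> complex tpoly \<Rightarrow> nat" where
  "waring_rank d f =
     (LEAST r. \<exists>l :: nat \<Rightarrow> complex tpoly. (\<forall>i<r. is_form 1 (l i)) \<and> f = (\<Sum>i<r. l i ^ d))"


section \<open>Transvectants\<close>

datatype triple = X | Y | Z

definition pd3 :: "3 \<Rightarrow> 3 \<Rightarrow> 3 \<Rightarrow> (triple \<times> 3, 'c::comm_ring_1) mpoly \<Rightarrow> (triple \<times> 3, 'c) mpoly" where
  "pd3 i j k P = pd (X, i) (pd (Y, j) (pd (Z, k) P))"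

definition Omega :: "(triple \<times> 3, 'c::comm_ring_1) mpoly \<Rightarrow> (triple \<times> 3, 'c) mpoly" where
  "Omega P = pd3 1 2 3 P + pd3 2 3 1 P + pd3 3 1 2 P - pd3 1 3 2 P - pd3 2 1 3 P - pd3 3 2 1 P"

definition transvectant :: "nat \<Rightarrow> 'c::comm_ring_1 tpoly \<Rightarrow> 'c tpoly \<Rightarrow> 'c tpoly \<Rightarrow> 'c tpoly" where
  "transvectant n f g h =
     rename snd ((Omega ^^ n) (rename (Pair X) f * rename (Pair Y) g * rename (Pair Z) h))"


section \<open>Concomitants of a ternary cubic\<close>

definition Hessian :: "complex tpoly \<Rightarrow> complex tpoly" where
  "Hessian f = const (1/12) * transvectant 2 f f f"

text \<open>
  Forms in \<open>x\<close> whose coefficients are polynomials in \<open>u\<close> have type \<open>complex tpoly tpoly\<close>: the outer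
  variables are the \<open>x\<^sub>i\<close>, the inner ones the \<open>u\<^sub>i\<close>.
\<close>

definition u_x :: "complex tpoly tpoly" where
  "u_x = (\<Sum>i\<in>UNIV. const (var i) * var i)"

definition times_u_x :: "complex tpoly \<Rightarrow> complex tpoly tpoly" where
  "times_u_x f = Poly_Mapping.map const f * u_x"

text \<open>
  The fourth transvectant of three quartic forms in \<open>x\<close> has degree \<open>0\<close> in \<open>x\<close>; taking the
  coefficient of the monomial \<open>x\<^sup>0\<close> reads it as a polynomial in \<open>u\<close>.
\<close>

definition S_uuu :: "complex tpoly \<Rightarrow> complex tpoly" where
  "S_uuu f = const (1/576) *
     Poly_Mapping.lookup (transvectant 4 (times_u_x f) (times_u_x f) (times_u_x f)) 0"

definition T_uuu :: "complex tpoly \<Rightarrow> complex tpoly" where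
  "T_uuu f = const (1/576) *
     Poly_Mapping.lookup (transvectant 4 (times_u_x f) (times_u_x f) (times_u_x (Hessian f))) 0"

text \<open>
  The substitution \<open>u\<^sup>3 \<mapsto> f\<close>: the linear map on cubic forms in \<open>u\<close> that sends
  \<open>3!/(i! j! k!) u\<^sub>1\<^sup>i u\<^sub>2\<^sup>j u\<^sub>3\<^sup>k\<close> to the coefficient of
  \<open>x\<^sub>1\<^sup>i x\<^sub>2\<^sup>j x\<^sub>3\<^sup>k\<close> in \<open>f\<close>.
\<close>

definition subst_u3 :: "complex tpoly \<Rightarrow> complex tpoly \<Rightarrow> complex" where
  "subst_u3 f P = (\<Sum>m \<in> Poly_Mapping.keys P.
     Poly_Mapping.lookup P m * ((\<Prod>i\<in>UNIV. fact (Poly_Mapping.lookup m i)) / fact 3)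
       * Poly_Mapping.lookup f m)"

definition Aronhold_S :: "complex tpoly \<Rightarrow> complex" where
  "Aronhold_S f = subst_u3 f (S_uuu f)"

definition Aronhold_T :: "complex tpoly \<Rightarrow> complex" where
  "Aronhold_T f = subst_u3 f (T_uuu f)"

end

theory Submission
  imports Defs "HOL-Analysis.Determinants" "HOL-Computational_Algebra.Fundamental_Theorem_Algebra"
begin

text \<open>
  Writing a cubic as a combination of cubes of linear forms \<open>a, b, c, \<dots>\<close> turns \<open>S\<close> and \<open>T\<close> into sums of
  products of brackets, e.g. \<open>S = 9 \<Sum> [abc][dbc][adc][abd]\<close>. These formulas show that both are
  covariant under linear substitutions, that the Hessian and hence \<open>T\<close> vanish on sums of at most two
  cubes, and that \<open>S = 0\<close>, \<open>T = 972 [abc]\<^sup>6\<close> on \<open>a\<^sup>3 + b\<^sup>3 + c\<^sup>3\<close>.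

  Conversely, let \<open>S = 0 \<noteq> T\<close>. Some polar conic of \<open>f\<close> is singular, that is, there are nonzero \<open>p, q\<close> with
  \<open>f(p, q, \<cdot>) = 0\<close>. If \<open>p, q\<close> can be chosen independent, then in suitable coordinates \<open>f\<close> has no
  monomial divisible by \<open>xy\<close>, and \<open>S\<close> is a constant times the product of the discriminants of the polars
  of the two points. So one of these polars is a square, which makes \<open>f\<close> either \<open>x\<^sup>3\<close> plus a binary cubic
  or a cuspidal nullform with \<open>T = 0\<close>; the same polar argument diagonalizes the binary cubic. Otherwise \<open>p\<close> is a
  node and \<open>f = b y\<^sup>3 + c z\<^sup>3 + 6 m x y z\<close> with \<open>m \<noteq> 0\<close>, for which \<open>S \<noteq> 0\<close>.
\<close>

section \<open>Polynomials\<close>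

abbreviation single where "single \<equiv> Poly_Mapping.single"
abbreviation lookup where "lookup \<equiv> Poly_Mapping.lookup"
abbreviation keys where "keys \<equiv> Poly_Mapping.keys"

lemma sum_single_lookup: "(\<Sum>m\<in>keys p. single m (lookup p m)) = p"
  by (rule poly_mapping_eqI)
    (auto simp: lookup_sum lookup_single when_def in_keys_iff)

lemma poly_mapping_single_induct [case_names zero add single]:
  fixes p :: "'a \<Rightarrow>\<^sub>0 'b::comm_monoid_add"
  assumes "P 0" "\<And>p q. P p \<Longrightarrow> P q \<Longrightarrow> P (p + q)" "\<And>m c. P (single m c)"
  shows "P p"
proof -
  have "P (\<Sum>m\<in>A. single m (lookup p m))" if "finite A" for A
    using that by induction (auto intro: assms)
  from this[of "keys p"] show ?thesis
    by (simp add: sum_single_lookup)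
qed

text \<open>Both sides are biadditive, so multiplicativity need only be checked on monomials. Serves
  \<open>rename\<close> and \<open>map_const\<close>.\<close>

lemma additive_imp_multiplicative:
  fixes F :: "('a::comm_monoid_add \<Rightarrow>\<^sub>0 'b::comm_ring_1) \<Rightarrow> 'c::comm_ring_1"
  assumes zero: "F 0 = 0" and add: "\<And>p q. F (p + q) = F p + F q"
    and mult: "\<And>m n c d. F (single m c * single n d) = F (single m c) * F (single n d)"
  shows "F (p * q) = F p * F q"
proof (induction p rule: poly_mapping_single_induct)
  case (single m c)
  show ?case
    by (induction q rule: poly_mapping_single_induct)
      (simp_all add: zero add algebra_simps mult)
qed (simp_all add: zero add algebra_simps)

lemma const_0 [simp]: "const 0 = 0"
  and const_1 [simp]: "const 1 = 1"
  and const_numeral [simp]: "const (numeral n) = numeral n"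
  by (simp_all add: const_def)

lemma const_add: "const (a + b) = const a + const b"
  and const_diff: "const (a' - b') = const a' - const (b'::'a::ab_group_add)"
  and const_minus: "const (- b') = - const b'"
  by (simp_all add: const_def single_add single_diff single_uminus)

lemma const_mult: "const (a * b) = const a * const b"
  by (simp add: const_def mult_single)

lemma const_power: "const (a ^ n) = const a ^ n"
  by (induction n) (simp_all add: const_mult)

lemma const_sum: "const (sum f A) = (\<Sum>i\<in>A. const (f i))"
  by (induction A rule: infinite_finite_induct) (simp_all add: const_add)

lemma lookup_const_0 [simp]: "lookup (const c) 0 = c"
  by (simp add: const_def)

lemmas const_hom = const_add const_diff const_minus const_mult const_power

section \<open>Formal partial derivatives\<close>

lemma pd_superset:
  assumes "finite A" "keys p \<subseteq> A"
  shows "pd v p = (\<Sum>m\<in>A. single (m - single v 1) (of_nat (lookup m v) * lookup p m))"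
  unfolding pd_def using assms
  by (intro sum.mono_neutral_left) (auto simp: in_keys_iff)

lemma pd_0 [simp]: "pd v 0 = 0"
  by (simp add: pd_def)

lemma pd_single: "pd v (single m c) = single (m - single v 1) (of_nat (lookup m v) * c)"
  by (subst pd_superset[of "{m}"]) auto

lemma pd_add: "pd v (p + q) = pd v p + pd v q"
  by (subst (1 2 3) pd_superset[of "keys p \<union> keys q"])
    (use keys_add[of p q] in \<open>auto simp: lookup_add algebra_simps single_add sum.distrib\<close>)

lemma pd_sum: "pd v (sum f A) = (\<Sum>i\<in>A. pd v (f i))"
  by (induction A rule: infinite_finite_induct) (simp_all add: pd_add)

lemma pd_mult: "pd v (p * q) = pd v p * q + p * pd v q"
proof (induction p rule: poly_mapping_single_induct)
  case (single m c)
  show ?case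
  proof (induction q rule: poly_mapping_single_induct)
    case (single n d)
    \<comment> \<open>Exponent subtraction truncates at zero, so moving it past the sum needs
      \<open>v\<close> to occur in \<open>m\<close>; otherwise the coefficient
      \<open>lookup m v\<close> is zero and both terms vanish.\<close>
    have *: "m + n - single v 1 = m - single v 1 + n" if "lookup m v \<noteq> 0" for m n :: "'a \<Rightarrow>\<^sub>0 nat"
      using that by (intro poly_mapping_eqI) (auto simp: lookup_add lookup_minus lookup_single when_def)
    have 1: "single (m + n - single v 1) (of_nat (lookup m v) * c * d) =
        single (m - single v 1 + n) (of_nat (lookup m v) * c * d)"
      by (cases "lookup m v = 0") (simp_all add: * del: One_nat_def)
    have 2: "single (m + n - single v 1) (of_nat (lookup n v) * c * d) =
        single (m + (n - single v 1)) (of_nat (lookup n v) * c * d)"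
      using *[of n m] by (cases "lookup n v = 0") (simp_all add: ac_simps del: One_nat_def)
    show ?case
      using 1 2 by (simp add: pd_single mult_single lookup_add algebra_simps single_add)
  qed (simp_all add: pd_add algebra_simps)
qed (simp_all add: pd_add algebra_simps)

lemma pd_const [simp]: "pd v (const c) = 0"
  by (simp add: const_def pd_single)

lemma pd_1 [simp]: "pd v 1 = 0"
  using pd_const[of v 1] by (simp del: pd_const)

lemma pd_var: "pd v (var w) = (if v = w then 1 else 0)"
  by (auto simp: var_def pd_single lookup_single when_def)

section \<open>Substitution of variables for variables\<close>

lemma rename_superset:
  assumes "finite A" "keys p \<subseteq> A"
  shows "rename r p = (\<Sum>m\<in>A. single (\<Sum>v\<in>keys m. single (r v) (lookup m v)) (lookup p m))"
  unfolding rename_def using assms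
  by (intro sum.mono_neutral_left) (auto simp: in_keys_iff)

lemma rename_0 [simp]: "rename r 0 = 0"
  by (simp add: rename_def)

lemma rename_single: "rename r (single m c) = single (\<Sum>v\<in>keys m. single (r v) (lookup m v)) c"
  by (subst rename_superset[of "{m}"]) auto

lemma rename_add: "rename r (p + q) = rename r p + rename r q"
  by (subst (1 2 3) rename_superset[of "keys p \<union> keys q"])
    (use keys_add[of p q] in \<open>auto simp: lookup_add algebra_simps single_add sum.distrib\<close>)

lemma rename_sum: "rename r (sum f A) = (\<Sum>i\<in>A. rename r (f i))"
  by (induction A rule: infinite_finite_induct) (simp_all add: rename_add)

lemma rename_mult:
  fixes r :: "'v \<Rightarrow> 'w"
  shows "rename r (p * q) = rename r p * rename r q"
proof (rule additive_imp_multiplicative)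
  fix m n :: "'v \<Rightarrow>\<^sub>0 nat" and c d :: 'a
  \<comment> \<open>Sums over the supports of \<open>m\<close>, \<open>n\<close> and
    \<open>m + n\<close> become comparable on a common index set.\<close>
  have *: "(\<Sum>v\<in>keys p. single (r v) (lookup p v)) = (\<Sum>v\<in>keys m \<union> keys n. single (r v) (lookup p v))"
    if "keys p \<subseteq> keys m \<union> keys n" for p :: "'v \<Rightarrow>\<^sub>0 nat"
    using that by (intro sum.mono_neutral_left) (auto simp: in_keys_iff)
  have "(\<Sum>v\<in>keys (m + n). single (r v) (lookup (m + n) v)) =
      (\<Sum>v\<in>keys m. single (r v) (lookup m v)) + (\<Sum>v\<in>keys n. single (r v) (lookup n v))"
    using *[of m] *[of n] *[OF keys_add]
    by (simp add: lookup_add single_add sum.distrib)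
  then show "rename r (single m c * single n d) = rename r (single m c) * rename r (single n d)"
    by (simp add: rename_single mult_single)
qed (simp_all add: rename_add)

lemma rename_const [simp]: "rename r (const c) = const c"
  by (simp add: const_def rename_single)

lemma rename_1 [simp]: "rename r 1 = 1"
  using rename_const[of r 1] by (simp del: rename_const)

lemma rename_var [simp]: "rename r (var v) = var (r v)"
  by (simp add: var_def rename_single)

lemma rename_power: "rename r (p ^ n) = rename r p ^ n"
  by (induction n) (simp_all add: rename_mult)

section \<open>Extension of the coefficient ring\<close>

abbreviation map_const :: "('v, 'c::comm_ring_1) mpoly \<Rightarrow> ('v, ('w, 'c) mpoly) mpoly" where
  "map_const \<equiv> Poly_Mapping.map const"

lemma map_const_add: "map_const (p + q) = map_const p + map_const q"
  by (rule poly_mapping_eqI) (auto simp: lookup_add map.rep_eq when_def simp flip: const_add)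

lemma map_const_0 [simp]: "map_const 0 = 0"
  by (rule poly_mapping_eqI) (simp add: map.rep_eq)

lemma map_const_sum: "map_const (sum f A) = (\<Sum>i\<in>A. map_const (f i))"
  by (induction A rule: infinite_finite_induct) (simp_all add: map_const_add)

lemma map_const_mult: "map_const (p * q) = map_const p * map_const q"
  by (rule additive_imp_multiplicative) (simp_all add: map_const_add mult_single const_mult)

lemma map_const_const [simp]: "map_const (const c) = const (const c)"
  by (simp add: const_def[of c] const_def[of "single 0 c"])

lemma map_const_var [simp]: "map_const (var v) = var v"
  by (simp add: var_def)

lemma map_const_1 [simp]: "map_const 1 = 1"
  using map_const_const[of 1] by (simp del: map_const_const)

lemma map_const_power: "map_const (p ^ n) = map_const p ^ n"
  by (induction n) (simp_all add: map_const_mult)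

section \<open>Transvectants of powers of linear forms\<close>

definition lf :: "(3 \<Rightarrow> 'c::comm_ring_1) \<Rightarrow> 'c tpoly" where
  "lf w = (\<Sum>i\<in>UNIV. const (w i) * var i)"

definition lf_at :: "triple \<Rightarrow> (3 \<Rightarrow> 'c::comm_ring_1) \<Rightarrow> (triple \<times> 3, 'c) mpoly" where
  "lf_at t w = (\<Sum>i\<in>UNIV. const (w i) * var (t, i))"

text \<open>The determinant with rows \<open>a\<close>, \<open>b\<close>, \<open>c\<close>: the
  bracket [abc] of the symbolic method.\<close>

definition br :: "(3 \<Rightarrow> 'c::comm_ring_1) \<Rightarrow> (3 \<Rightarrow> 'c) \<Rightarrow> (3 \<Rightarrow> 'c) \<Rightarrow> 'c" where
  "br a b c = a 1 * b 2 * c 3 + a 2 * b 3 * c 1 + a 3 * b 1 * c 2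
    - a 1 * b 3 * c 2 - a 2 * b 1 * c 3 - a 3 * b 2 * c 1"

lemma lf_add: "lf (\<lambda>i. v i + w i) = lf v + lf w"
  by (simp add: lf_def const_add algebra_simps sum.distrib)

lemma lf_scale: "lf (\<lambda>i. k * w i) = const k * lf w"
  by (simp add: lf_def const_mult sum_distrib_left algebra_simps)

lemma lf_diff: "lf (\<lambda>i. v i - w i) = lf v - lf w"
  by (simp add: lf_def const_diff algebra_simps sum_subtractf)

lemma lf_minus: "lf (\<lambda>i. - w i) = - lf w"
  by (simp add: lf_def const_minus sum_negf)

lemma rename_Pair_lf [simp]: "rename (Pair t) (lf w) = lf_at t w"
  by (simp add: lf_def lf_at_def rename_sum rename_mult)

lemma rename_snd_lf_at [simp]: "rename snd (lf_at t w) = lf w"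
  by (simp add: lf_def lf_at_def rename_sum rename_mult)

lemma map_const_lf [simp]: "map_const (lf w) = lf (\<lambda>i. const (w i))"
  by (simp add: lf_def map_const_sum map_const_mult)

lemma pd_lf_at: "pd (s, i) (lf_at t w) = (if s = t then const (w i) else 0)"
proof -
  have "pd (s, i) (lf_at t w) = (\<Sum>j\<in>UNIV. if j = i then if s = t then const (w i) else 0 else 0)"
    unfolding lf_at_def pd_sum by (intro sum.cong) (auto simp: pd_mult pd_var)
  then show ?thesis by simp
qed

lemma pd_power: "pd v (p ^ n) = of_nat n * p ^ (n - 1) * pd v p"
proof (induction n)
  case (Suc n)
  then show ?case
    by (cases n) (simp_all add: pd_mult algebra_simps)
qed simp

lemma pd_of_nat [simp]: "pd v (of_nat n) = 0"
  by (induction n) (simp_all add: pd_add)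

lemma const_of_nat [simp]: "const (of_nat n) = of_nat n"
  by (simp add: const_def)

text \<open>Each derivative meets only the factor in its own triple of variables and brings out one
  coefficient and one exponent. The signed sum of the coefficient products over the six index orders
  is the bracket.\<close>

lemma Omega_powers:
  "Omega (lf_at X a ^ Suc n * lf_at Y b ^ Suc n * lf_at Z c ^ Suc n) =
    const (of_nat (Suc n) ^ 3 * br a b c) * (lf_at X a ^ n * lf_at Y b ^ n * lf_at Z c ^ n)"
proof -
  have "pd3 i j k (lf_at X a ^ Suc n * lf_at Y b ^ Suc n * lf_at Z c ^ Suc n) =
      const (a i) * const (b j) * const (c k) *
      (of_nat (Suc n) ^ 3 * (lf_at X a ^ n * lf_at Y b ^ n * lf_at Z c ^ n))" for i j k
    by (simp add: pd3_def pd_mult pd_power pd_lf_at power3_eq_cube del: power_Suc of_nat_Suc)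
  then show ?thesis
    unfolding Omega_def br_def by (simp only: const_hom) (simp add: algebra_simps del: of_nat_Suc)
qed

section \<open>Trilinearity of the transvectants\<close>

lemma Omega_0 [simp]: "Omega 0 = 0"
  by (simp add: Omega_def pd3_def)

lemma Omega_add: "Omega (P + Q) = Omega P + Omega Q"
  by (simp add: Omega_def pd3_def pd_add)

lemma Omega_scale: "Omega (const c * P) = const c * Omega P"
  by (simp add: Omega_def pd3_def pd_mult algebra_simps)

lemma Omega_pow_add: "(Omega ^^ n) (P + Q) = (Omega ^^ n) P + (Omega ^^ n) Q"
  by (induction n) (simp_all add: Omega_add)

lemma Omega_pow_0 [simp]: "(Omega ^^ n) 0 = 0"
  by (induction n) simp_all

lemma Omega_pow_scale: "(Omega ^^ n) (const c * P) = const c * (Omega ^^ n) P"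
  by (induction n) (simp_all add: Omega_scale)

lemma transvectant_add:
  "transvectant n (f + f') g h = transvectant n f g h + transvectant n f' g h"
  "transvectant n f (g + g') h = transvectant n f g h + transvectant n f g' h"
  "transvectant n f g (h + h') = transvectant n f g h + transvectant n f g h'"
  by (simp_all add: transvectant_def rename_add ring_distribs Omega_pow_add)

lemma transvectant_0 [simp]:
  "transvectant n 0 g h = 0" "transvectant n f 0 h = 0" "transvectant n f g 0 = 0"
  by (simp_all add: transvectant_def)

lemma transvectant_scale:
  "transvectant n (const k * f) g h = const k * transvectant n f g h"
  "transvectant n f (const k * g) h = const k * transvectant n f g h"
  "transvectant n f g (const k * h) = const k * transvectant n f g h"
  by (simp_all add: transvectant_def rename_mult Omega_pow_scale mult.assoc mult.left_commute[of _ "const k"])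

lemma transvectant_sum:
  shows "transvectant n (sum f I) g h = (\<Sum>i\<in>I. transvectant n (f i) g h)"
    and "transvectant n g (sum f I) h = (\<Sum>i\<in>I. transvectant n g (f i) h)"
    and "transvectant n g h (sum f I) = (\<Sum>i\<in>I. transvectant n g h (f i))"
  by (induction I rule: infinite_finite_induct; simp add: transvectant_add)+

lemma transvectant_lincomb:
  "transvectant n (\<Sum>i\<in>I. const (p i) * f i) (\<Sum>j\<in>J. const (q j) * g j) (\<Sum>k\<in>K. const (r k) * h k) =
    (\<Sum>i\<in>I. \<Sum>j\<in>J. \<Sum>k\<in>K. const (p i * q j * r k) * transvectant n (f i) (g j) (h k))"
  unfolding transvectant_sum(1) unfolding transvectant_sum(2) unfolding transvectant_sum(3)
  unfolding transvectant_scale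
  by (simp add: sum_distrib_left const_mult ac_simps)

lemma Omega_powers_numeral:
  "Omega (lf_at X a ^ 4 * lf_at Y b ^ 4 * lf_at Z c ^ 4) =
     const (64 * br a b c) * (lf_at X a ^ 3 * lf_at Y b ^ 3 * lf_at Z c ^ 3)"
  "Omega (lf_at X a ^ 3 * lf_at Y b ^ 3 * lf_at Z c ^ 3) =
     const (27 * br a b c) * (lf_at X a ^ 2 * lf_at Y b ^ 2 * lf_at Z c ^ 2)"
  "Omega (lf_at X a ^ 2 * lf_at Y b ^ 2 * lf_at Z c ^ 2) =
     const (8 * br a b c) * (lf_at X a * lf_at Y b * lf_at Z c)"
  "Omega (lf_at X a * lf_at Y b * lf_at Z c) = const (br a b c)"
  using Omega_powers[of a 3 b c] Omega_powers[of a 2 b c] Omega_powers[of a 1 b c]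
    Omega_powers[of a 0 b c]
  by (simp_all add: numeral_eq_Suc)

lemma transvectant_2_cubes:
  "transvectant 2 (lf a ^ 3) (lf b ^ 3) (lf c ^ 3) =
    const (216 * br a b c ^ 2) * (lf a * lf b * lf c)"
proof -
  have Omega_Omega: "(Omega ^^ 2) P = Omega (Omega P)" for P :: "(triple \<times> 3, 'a) mpoly"
    by (simp add: numeral_eq_Suc)
  have "(Omega ^^ 2) (lf_at X a ^ 3 * lf_at Y b ^ 3 * lf_at Z c ^ 3) =
      const (216 * br a b c ^ 2) * (lf_at X a * lf_at Y b * lf_at Z c)"
    by (simp only: Omega_Omega Omega_powers_numeral Omega_scale) (simp add: const_hom power2_eq_square)
  then show ?thesis
    by (simp add: transvectant_def rename_power rename_mult)
qed

lemma transvectant_4_fourth_powers: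
  "transvectant 4 (lf a ^ 4) (lf b ^ 4) (lf c ^ 4) = const (13824 * br a b c ^ 4)"
proof -
  have "(Omega ^^ 4) P = Omega (Omega (Omega (Omega P)))" for P :: "(triple \<times> 3, 'a) mpoly"
    by (simp add: numeral_eq_Suc)
  then have "(Omega ^^ 4) (lf_at X a ^ 4 * lf_at Y b ^ 4 * lf_at Z c ^ 4) = const (13824 * br a b c ^ 4)"
    by (simp only: Omega_powers_numeral Omega_scale) (simp add: const_hom power4_eq_xxxx)
  then show ?thesis
    by (simp add: transvectant_def rename_power rename_mult)
qed

text \<open>Polarization: \<open>48 a\<^sup>3u = 8((a+u)\<^sup>4 - (a-u)\<^sup>4) - ((a+2u)\<^sup>4 - (a-2u)\<^sup>4)\<close> reduces this to fourth powers.\<close>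

lemma transvectant_4_cube_times:
  fixes h :: "'c::comm_ring_1"
  assumes h: "48 * h = 1"
  shows "transvectant 4 (lf a ^ 3 * lf u) (lf b ^ 3 * lf u) (lf c ^ 3 * lf u) =
    const (5184 * br a b c * br u b c * br a u c * br a b (u :: 3 \<Rightarrow> 'c))"
proof -
  define \<kappa> w :: "nat \<Rightarrow> 'c" where "\<kappa> = (!) [1, -1, 2, -2]" and "w = (!) [8, -8, -1, 1]"
  have expand: "(\<Sum>i<4. F i) = F 0 + F 1 + F 2 + F (3::nat)" for F :: "nat \<Rightarrow> 'd::comm_monoid_add"
    by (simp add: eval_nat_numeral add.assoc)
  note vals = \<kappa>_def w_def
  have H: "48 * const h = (1 :: 'c tpoly)"
    using arg_cong[OF h, of const] by (simp add: const_mult)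
  have pol: "lf v ^ 3 * lf u = (\<Sum>i<4. const (h * w i) * lf (\<lambda>j. v j + \<kappa> i * u j) ^ 4)" for v
  proof -
    have "lf v ^ 3 * lf u = 48 * const h * (lf v ^ 3 * lf u)"
      by (simp add: H)
    also have "\<dots> = (\<Sum>i<4. const (h * w i) * lf (\<lambda>j. v j + \<kappa> i * u j) ^ 4)"
      unfolding expand vals by (simp add: lf_add lf_diff lf_minus lf_scale const_hom)
        (simp add: power3_eq_cube power4_eq_xxxx algebra_simps)
    finally show ?thesis .
  qed
  \<comment> \<open>Brackets with \<open>u\<close> in two slots vanish, so the trilinear expansion
    stops after first order.\<close>
  have br: "br (\<lambda>j. a j + k * u j) (\<lambda>j. b j + l * u j) (\<lambda>j. c j + m * u j) =
      br a b c + k * br u b c + l * br a u c + m * br a b u" for k l m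
    unfolding br_def by (simp add: algebra_simps)
  define D \<alpha> \<beta> \<gamma> where "D = br a b c" "\<alpha> = br u b c" "\<beta> = br a u c" "\<gamma> = br a b u"
  have "transvectant 4 (lf a ^ 3 * lf u) (lf b ^ 3 * lf u) (lf c ^ 3 * lf u) =
     const (h ^ 3 * 13824 * (\<Sum>i<4. \<Sum>j<4. \<Sum>k<4. w i * w j * w k * (D + \<kappa> i * \<alpha> + \<kappa> j * \<beta> + \<kappa> k * \<gamma>) ^ 4))"
    unfolding pol transvectant_lincomb transvectant_4_fourth_powers br D_\<alpha>_\<beta>_\<gamma>_def
    by (simp add: const_sum sum_distrib_left const_hom algebra_simps power3_eq_cube)
  also have "(\<Sum>i<4. \<Sum>j<4. \<Sum>k<4. w i * w j * w k * (D + \<kappa> i * \<alpha> + \<kappa> j * \<beta> + \<kappa> k * \<gamma>) ^ 4) =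
      41472 * D * \<alpha> * \<beta> * \<gamma>"
  proof -
    \<comment> \<open>The weights \<open>w\<close> at the nodes \<open>\<kappa>\<close> have moments
      0, 12, 0, 0, 0, so summation turns a polynomial of degree at most four into 12 times its
      derivative. Three nested sums thus give 12^3 * 24 = 41472.\<close>
    have "(\<Sum>k<4. w k * (p + \<kappa> k * q) ^ 4) = 48 * p ^ 3 * q"
      "(\<Sum>k<4. w k * (p + \<kappa> k * q) ^ 3) = 36 * p ^ 2 * q"
      "(\<Sum>k<4. w k * (p + \<kappa> k * q) ^ 2) = 24 * p * q" for p q
      unfolding expand vals
      by (simp_all add: power2_eq_square power3_eq_cube power4_eq_xxxx algebra_simps)
    note w_sums = this
    have "(\<Sum>i<4. \<Sum>j<4. \<Sum>k<4. w i * w j * w k * (D + \<kappa> i * \<alpha> + \<kappa> j * \<beta> + \<kappa> k * \<gamma>) ^ 4) =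
        (\<Sum>i<4. w i * (\<Sum>j<4. w j * (\<Sum>k<4. w k * (D + \<kappa> i * \<alpha> + \<kappa> j * \<beta> + \<kappa> k * \<gamma>) ^ 4)))"
      by (simp only: sum_distrib_left mult.assoc)
    also have "\<dots> = (\<Sum>i<4. w i * ((\<Sum>j<4. w j * (D + \<kappa> i * \<alpha> + \<kappa> j * \<beta>) ^ 3) * (48 * \<gamma>)))"
      by (simp only: w_sums(1)) (simp only: sum_distrib_left sum_distrib_right mult_ac)
    also have "\<dots> = (\<Sum>i<4. w i * (D + \<kappa> i * \<alpha>) ^ 2) * (36 * \<beta> * (48 * \<gamma>))"
      by (simp only: w_sums(2)) (simp only: sum_distrib_left sum_distrib_right mult_ac)
    also have "\<dots> = 41472 * D * \<alpha> * \<beta> * \<gamma>"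
      by (simp add: w_sums)
    finally show ?thesis .
  qed
  also have "h ^ 3 * 13824 * (41472 * D * \<alpha> * \<beta> * \<gamma>) = 5184 * D * \<alpha> * \<beta> * \<gamma>"
  proof -
    have "h ^ 3 * 13824 * (41472 * D * \<alpha> * \<beta> * \<gamma>) = (48 * h) ^ 3 * (5184 * D * \<alpha> * \<beta> * \<gamma>)"
      by (simp add: power_mult_distrib)
    then show ?thesis by (simp add: h)
  qed
  finally show ?thesis
    by (simp add: D_\<alpha>_\<beta>_\<gamma>_def)
qed

section \<open>Forms in coordinates\<close>

definition mon :: "nat \<Rightarrow> nat \<Rightarrow> nat \<Rightarrow> 3 \<Rightarrow>\<^sub>0 nat" where
  "mon a b c = single 1 a + single 2 b + single 3 c"

lemma lookup_mon: "lookup (mon a b c) 1 = a" "lookup (mon a b c) 2 = b" "lookup (mon a b c) 3 = c"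
  by (simp_all add: mon_def lookup_add lookup_single)

lemma mon_eq_iff [simp]: "mon a b c = mon a' b' c' \<longleftrightarrow> a = a' \<and> b = b' \<and> c = c'"
  by (metis lookup_mon)

lemma mon_add: "mon a b c + mon a' b' c' = mon (a + a') (b + b') (c + c')"
  by (simp add: mon_def single_add ac_simps)

lemma mon_lookup: "mon (lookup m 1) (lookup m 2) (lookup m 3) = m"
  by (rule poly_mapping_eqI) (metis exhaust_3 lookup_mon)

lemma var_mon: "var 1 = single (mon 1 0 0) 1" "var 2 = single (mon 0 1 0) 1" "var 3 = single (mon 0 0 1) 1"
  by (simp_all add: var_def mon_def)

lemma const_mult_single: "const c * single m d = single m (c * d)"
  by (simp add: const_def mult_single)

lemma lf_expand: "lf w = const (w 1) * var 1 + const (w 2) * var 2 + const (w 3) * var 3"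
  by (simp add: lf_def sum_3)

lemma lf_mon: "lf w = single (mon 1 0 0) (w 1) + single (mon 0 1 0) (w 2) + single (mon 0 0 1) (w 3)"
  by (simp add: lf_expand var_mon const_mult_single)

lemma lf_cube:
  "lf (g :: 3 \<Rightarrow> complex) ^ 3 = 
     single (mon 3 0 0) (g 1 ^ 3) + single (mon 0 3 0) (g 2 ^ 3) + single (mon 0 0 3) (g 3 ^ 3) +
     single (mon 2 1 0) (3 * g 1 ^ 2 * g 2) + single (mon 2 0 1) (3 * g 1 ^ 2 * g 3) +
     single (mon 1 2 0) (3 * g 1 * g 2 ^ 2) + single (mon 0 2 1) (3 * g 2 ^ 2 * g 3) +
     single (mon 1 0 2) (3 * g 1 * g 3 ^ 2) + single (mon 0 1 2) (3 * g 2 * g 3 ^ 2) +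
     single (mon 1 1 1) (6 * g 1 * g 2 * g 3)"
proof -
  \<comment> \<open>Multiples become repeated summands, so that the 27 terms of the expanded product
    match up to order.\<close>
  have 3: "single m (3 * a) = single m a + single m a + single m a"
    and 6: "single m (6 * a) = single m a + single m a + single m a + single m a + single m a + single m a"
    for m :: "3 \<Rightarrow>\<^sub>0 nat" and a :: complex
    by (simp_all flip: single_add)
  show ?thesis
    unfolding lf_mon power3_eq_cube ring_distribs mult_single mon_add mult.assoc 3 6
    by (simp add: numeral_2_eq_2 numeral_3_eq_3 ac_simps)
qed

lemma sum_lookup_eq_lookup_superset:
  assumes "finite A" "keys p \<subseteq> A"
  shows "p = (\<Sum>m\<in>A. single m (lookup p m))"
proof -
  have "(\<Sum>m\<in>A. single m (lookup p m)) = (\<Sum>m\<in>keys p. single m (lookup p m))"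
    using assms by (intro sum.mono_neutral_right) (auto simp: in_keys_iff)
  then show ?thesis
    by (simp add: sum_single_lookup)
qed

lemma is_form_1_lf: "is_form 1 (lf w)"
proof -
  have "keys (lf w) \<subseteq> {mon 1 0 0, mon 0 1 0, mon 0 0 1}"
    unfolding lf_mon
    by (intro order_trans[OF keys_add] Un_least) (auto simp: keys_single)
  then show ?thesis
    unfolding is_form_def sum_3 by (auto simp: lookup_mon)
qed

lemma is_form_1_imp_lf:
  assumes "is_form 1 l"
  obtains w where "l = lf w"
proof -
  have "m \<in> {mon 1 0 0, mon 0 1 0, mon 0 0 1}" if "m \<in> keys l" for m
  proof -
    obtain a b c where m: "m = mon a b c"
      by (metis mon_lookup)
    then have abc: "a + b + c = 1"
      using assms that by (auto simp: is_form_def sum_3 lookup_mon)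
    then have "a \<in> {0, 1}" "b \<in> {0, 1}"
      by auto
    then show ?thesis
      using abc by (auto simp: m)
  qed
  then have "l = (\<Sum>m\<in>{mon 1 0 0, mon 0 1 0, mon 0 0 1}. single m (lookup l m))"
    by (intro sum_lookup_eq_lookup_superset) auto
  then have "l = lf (\<lambda>i. lookup l (if i = 1 then mon 1 0 0 else if i = 2 then mon 0 1 0 else mon 0 0 1))"
    by (simp add: lf_mon add.assoc)
  then show ?thesis by (rule that)
qed

lemma monomials:
  fixes c :: complex
  shows "const c * var 1 ^ 3 = single (mon 3 0 0) c" "const c * var 2 ^ 3 = single (mon 0 3 0) c"
    "const c * var 3 ^ 3 = single (mon 0 0 3) c" "const c * var 1 ^ 2 * var 2 = single (mon 2 1 0) c"
    "const c * var 1 ^ 2 * var 3 = single (mon 2 0 1) c" "const c * var 1 * var 2 ^ 2 = single (mon 1 2 0) c"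
    "const c * var 2 ^ 2 * var 3 = single (mon 0 2 1) c" "const c * var 1 * var 3 ^ 2 = single (mon 1 0 2) c"
    "const c * var 2 * var 3 ^ 2 = single (mon 0 1 2) c" "const c * var 1 * var 2 * var 3 = single (mon 1 1 1) c"
  by (simp_all add: var_mon power2_eq_square power3_eq_cube mult_single mon_add const_mult_single
      mult.assoc numeral_2_eq_2 numeral_3_eq_3)

lemma is_form_3_expand:
  fixes f :: "complex tpoly"
  assumes "is_form 3 f"
  shows "f = const (lookup f (mon 3 0 0)) * var 1 ^ 3 + const (lookup f (mon 0 3 0)) * var 2 ^ 3 + const (lookup f (mon 0 0 3)) * var 3 ^ 3
       + const (lookup f (mon 2 1 0)) * var 1 ^ 2 * var 2 + const (lookup f (mon 2 0 1)) * var 1 ^ 2 * var 3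
       + const (lookup f (mon 1 2 0)) * var 1 * var 2 ^ 2 + const (lookup f (mon 0 2 1)) * var 2 ^ 2 * var 3
       + const (lookup f (mon 1 0 2)) * var 1 * var 3 ^ 2 + const (lookup f (mon 0 1 2)) * var 2 * var 3 ^ 2
       + const (lookup f (mon 1 1 1)) * var 1 * var 2 * var 3"
proof -
  let ?M = "{mon 3 0 0, mon 0 3 0, mon 0 0 3, mon 2 1 0, mon 2 0 1, mon 1 2 0, mon 0 2 1,
    mon 1 0 2, mon 0 1 2, mon 1 1 1}"
  have "m \<in> ?M" if "m \<in> keys f" for m
  proof -
    obtain a b c where m: "m = mon a b c"
      by (metis mon_lookup)
    then have abc: "a + b + c = 3"
      using assms that by (auto simp: is_form_def sum_3 lookup_mon)
    have a: "a = 0 \<or> a = 1 \<or> a = 2 \<or> a = 3"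
      using abc by presburger
    have b: "b = 0 \<or> b = 1 \<or> b = 2 \<or> b = 3"
      using abc by presburger
    show ?thesis
      using a b abc unfolding m by (elim disjE) simp_all
  qed
  then have "f = (\<Sum>m\<in>?M. single m (lookup f m))"
    by (intro sum_lookup_eq_lookup_superset) auto
  also have "\<dots> = const (lookup f (mon 3 0 0)) * var 1 ^ 3 + const (lookup f (mon 0 3 0)) * var 2 ^ 3 + const (lookup f (mon 0 0 3)) * var 3 ^ 3
       + const (lookup f (mon 2 1 0)) * var 1 ^ 2 * var 2 + const (lookup f (mon 2 0 1)) * var 1 ^ 2 * var 3
       + const (lookup f (mon 1 2 0)) * var 1 * var 2 ^ 2 + const (lookup f (mon 0 2 1)) * var 2 ^ 2 * var 3
       + const (lookup f (mon 1 0 2)) * var 1 * var 3 ^ 2 + const (lookup f (mon 0 1 2)) * var 2 * var 3 ^ 2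
       + const (lookup f (mon 1 1 1)) * var 1 * var 2 * var 3"
    unfolding monomials by (simp add: add.assoc)
  finally show ?thesis .
qed

section \<open>The invariants of a sum of cubes\<close>

lemma subst_u3_superset:
  assumes "finite A" "keys P \<subseteq> A"
  shows "subst_u3 f P = (\<Sum>m\<in>A. lookup P m * ((\<Prod>i\<in>UNIV. fact (lookup m i)) / fact 3) * lookup f m)"
  unfolding subst_u3_def using assms
  by (intro sum.mono_neutral_left) (auto simp: in_keys_iff)

lemma subst_u3_single:
  "subst_u3 f (single m c) = c * ((\<Prod>i\<in>UNIV. fact (lookup m i)) / fact 3) * lookup f m"
  by (subst subst_u3_superset[of "{m}"]) auto

lemma subst_u3_0 [simp]: "subst_u3 f 0 = 0" "subst_u3 0 P = 0"
  by (simp_all add: subst_u3_def)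

lemma subst_u3_add: "subst_u3 f (P + Q) = subst_u3 f P + subst_u3 f Q"
  by (subst (1 2 3) subst_u3_superset[of "keys P \<union> keys Q"])
    (use keys_add[of P Q] in \<open>auto simp: lookup_add algebra_simps sum.distrib add_divide_distrib\<close>)

lemma subst_u3_sum: "subst_u3 f (sum P A) = (\<Sum>i\<in>A. subst_u3 f (P i))"
  by (induction A rule: infinite_finite_induct) (simp_all add: subst_u3_add)

lemma lookup_const_mult: "lookup (const c * p) m = c * lookup p m"
proof (induction p rule: poly_mapping_single_induct)
  case (single n d)
  then show ?case
    by (simp add: const_mult_single lookup_single when_def)
qed (simp_all add: algebra_simps lookup_add)

lemma subst_u3_scale: "subst_u3 f (const c * P) = c * subst_u3 f P"
proof (induction P rule: poly_mapping_single_induct)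
  case (single n d)
  then show ?case
    by (simp add: const_mult_single subst_u3_single)
qed (simp_all add: algebra_simps subst_u3_add)

lemma subst_u3_add_left: "subst_u3 (f + g) P = subst_u3 f P + subst_u3 g P"
  by (simp add: subst_u3_def lookup_add algebra_simps sum.distrib add_divide_distrib)

lemma subst_u3_scale_left: "subst_u3 (const c * f) P = c * subst_u3 f P"
  by (simp add: subst_u3_def lookup_const_mult) (simp add: sum_distrib_left ac_simps)

lemma subst_u3_sum_left: "subst_u3 (sum f A) P = (\<Sum>i\<in>A. subst_u3 (f i) P)"
  by (induction A rule: infinite_finite_induct) (simp_all add: subst_u3_add_left)

lemma prod_3: "prod f (UNIV :: 3 set) = f 1 * f 2 * f 3"
  unfolding UNIV_3 by (simp add: ac_simps)

text \<open>The factorials in \<open>subst_u3\<close> cancel the multinomial coefficients of the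
  cube, so on \<open>lf g ^ 3\<close> the substitution is evaluation of the cubic in u at the point
  \<open>g\<close>.\<close>

lemma subst_u3_cube_mon:
  assumes "a + b + c = 3"
  shows "subst_u3 (lf g ^ 3) (single (mon a b c) 1) = g 1 ^ a * g 2 ^ b * g 3 ^ c"
proof -
  have a: "a = 0 \<or> a = 1 \<or> a = 2 \<or> a = 3"
    using assms by presburger
  have b: "b = 0 \<or> b = 1 \<or> b = 2 \<or> b = 3"
    using assms by presburger
  have "lookup (lf g ^ 3) (mon a b c) * (fact a * fact b * fact c) = 6 * (g 1 ^ a * g 2 ^ b * g 3 ^ c)"
    unfolding lf_cube lookup_add lookup_single using a b assms
    by (elim disjE) (simp_all add: fact_numeral)
  then show ?thesis
    by (simp add: subst_u3_single prod_3 lookup_mon fact_numeral field_simps)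
qed

lemma subst_u3_cube_vars: "subst_u3 (lf g ^ 3) (var i * var j * var k) = g i * g j * g k"
proof -
  have "\<forall>i j k. subst_u3 (lf g ^ 3) (var i * var j * var k) = g i * g j * g k"
    unfolding forall_3 var_mon mult_single mon_add mult_1
    by (simp add: subst_u3_cube_mon mult.assoc mult.left_commute mult.commute)
  then show ?thesis by blast
qed

lemma sum_product3:
  fixes a b c :: "'i \<Rightarrow> 'a::comm_semiring_0"
  shows "(\<Sum>i\<in>A. a i) * (\<Sum>j\<in>B. b j) * (\<Sum>k\<in>C. c k) = (\<Sum>i\<in>A. \<Sum>j\<in>B. \<Sum>k\<in>C. a i * b j * c k)"
  by (simp only: sum_distrib_left[symmetric] sum_distrib_right[symmetric])

lemma subst_u3_cube:
  "subst_u3 (lf g ^ 3) (lf p * lf q * lf r) =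
    (\<Sum>i\<in>UNIV. g i * p i) * (\<Sum>i\<in>UNIV. g i * q i) * (\<Sum>i\<in>UNIV. g i * r i)"
proof -
  have vars: "const (p i) * var i * (const (q j) * var j) * (const (r k) * var k) =
      const (p i * q j * r k) * (var i * var j * var k)" for i j k
    by (simp only: const_mult mult_ac)
  have coeffs: "p i * q j * r k * (g i * g j * g k) = g i * p i * (g j * q j) * (g k * r k)" for i j k
    by (simp only: mult_ac)
  show ?thesis
    unfolding lf_def[of p] lf_def[of q] lf_def[of r] sum_product3 vars
      subst_u3_sum subst_u3_scale subst_u3_cube_vars coeffs by (rule refl)
qed

text \<open>The weights are kept apart from the linear forms, without taking cube roots, so that
  they can depend polynomially on the coefficients of a cubic while the vectors stay fixed.\<close>

definition csum :: "'i set \<Rightarrow> ('i \<Rightarrow> complex) \<Rightarrow> ('i \<Rightarrow> 3 \<Rightarrow> complex) \<Rightarrow> complex tpoly" where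
  "csum I p v = (\<Sum>i\<in>I. const (p i) * lf (v i) ^ 3)"

text \<open>The symbol of Aronhold's S: \<open>a\<close>, \<open>b\<close>, \<open>c\<close> come
  from the three arguments of the transvectant, \<open>d\<close> from the cubic substituted for
  u^3.\<close>

definition br4 :: "(3 \<Rightarrow> complex) \<Rightarrow> (3 \<Rightarrow> complex) \<Rightarrow> (3 \<Rightarrow> complex) \<Rightarrow> (3 \<Rightarrow> complex) \<Rightarrow> complex" where
  "br4 a b c d = br a b c * br d b c * br a d c * br a b d"

definition cross :: "(3 \<Rightarrow> complex) \<Rightarrow> (3 \<Rightarrow> complex) \<Rightarrow> 3 \<Rightarrow> complex" where
  "cross b c i = (if i = 1 then b 2 * c 3 - b 3 * c 2
     else if i = 2 then b 3 * c 1 - b 1 * c 3 else b 1 * c 2 - b 2 * c 1)"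

lemma sum_times_cross: "(\<Sum>i\<in>UNIV. a i * cross b c i) = br a b c"
  by (simp add: sum_3 cross_def br_def algebra_simps)

text \<open>Here \<open>var\<close> is the generic vector u, since \<open>u_x\<close> is
  \<open>lf var\<close>. A bracket with u in one slot is a linear form in u, and the cross product
  lists its coefficients.\<close>

lemma br_var:
  "br (var :: 3 \<Rightarrow> complex tpoly) (\<lambda>i. const (b i)) (\<lambda>i. const (c i)) = lf (cross b c)"
  "br (\<lambda>i. const (a i)) (var :: 3 \<Rightarrow> complex tpoly) (\<lambda>i. const (c i)) = lf (cross c a)"
  "br (\<lambda>i. const (a i)) (\<lambda>i. const (b i)) (var :: 3 \<Rightarrow> complex tpoly) = lf (cross a b)"
  by (simp_all add: br_def lf_expand cross_def const_hom algebra_simps)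

lemma br_const: "br (\<lambda>i. const (a i)) (\<lambda>i. const (b i)) (\<lambda>i. const (c i)) = const (br a b c)"
  by (simp add: br_def const_hom)

lemma times_u_x_csum:
  "times_u_x (csum I p v) =
    (\<Sum>i\<in>I. const (const (p i)) * (lf (\<lambda>j. const (v i j)) ^ 3 * lf var))"
proof -
  have "u_x = lf var" by (simp add: u_x_def lf_def)
  then show ?thesis
    by (simp add: times_u_x_def csum_def map_const_sum map_const_mult map_const_power
        sum_distrib_right mult.assoc)
qed

lemma transvectant_4_csum:
  "const (1 / 576) * lookup (transvectant 4 (times_u_x (csum I p a)) (times_u_x (csum J q b)) (times_u_x (csum K r c))) 0 =
    (\<Sum>i\<in>I. \<Sum>j\<in>J. \<Sum>k\<in>K. const (9 * p i * q j * r k * br (a i) (b j) (c k)) *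
      (lf (cross (b j) (c k)) * lf (cross (c k) (a i)) * lf (cross (a i) (b j))))"
proof -
  \<comment> \<open>The coefficients are polynomials in u and form no field, so the inverse of 48 is
    supplied as a constant polynomial.\<close>
  have "48 * const (1 / 48) = const (1 :: complex)"
    by (simp flip: const_numeral const_mult)
  then have 48: "48 * const (1 / 48 :: complex) = (1 :: complex tpoly)" by simp
  have 576: "const (1 / 576) * (const p * (5184 * const b * P * Q * R)) = const (9 * p * b) * (P * Q * R)"
    for p b and P Q R :: "complex tpoly"
  proof -
    have "9 * p * b = 1 / 576 * (p * (5184 * b))"
      by simp
    then show ?thesis by (simp only: const_mult const_numeral mult.assoc)
  qed
  have 9: "9 * (p i * q j * r k) * b = 9 * p i * q j * r k * b" for i j k b
    by (simp only: mult.assoc)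
  show ?thesis
    unfolding times_u_x_csum transvectant_lincomb transvectant_4_cube_times[OF 48] br_const br_var
      lookup_sum lookup_const_mult lookup_const_0 const_mult[symmetric] sum_distrib_left 576 9 by (rule refl)
qed

text \<open>Substituting the cube of \<open>d\<close> evaluates [ubc][auc][abu] at u =
  \<open>d\<close>; with the remaining factor [abc] this is \<open>br4\<close>.\<close>

lemma subst_u3_transvectant_4_csum:
  "subst_u3 (csum L s d) (const (1 / 576) *
     lookup (transvectant 4 (times_u_x (csum I p a)) (times_u_x (csum J q b)) (times_u_x (csum K r c))) 0) =
    9 * (\<Sum>i\<in>I. \<Sum>j\<in>J. \<Sum>k\<in>K. \<Sum>l\<in>L. p i * q j * r k * s l * br4 (a i) (b j) (c k) (d l))"
proof -
  have * : "subst_u3 (csum L s d) (lf (cross b c) * lf (cross c a) * lf (cross a b)) =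
      (\<Sum>l\<in>L. s l * (br (d l) b c * br a (d l) c * br a b (d l)))" for a b c
    unfolding csum_def subst_u3_sum_left subst_u3_scale_left subst_u3_cube sum_times_cross
    by (intro sum.cong) (simp_all add: br_def algebra_simps)
  show ?thesis
    unfolding transvectant_4_csum subst_u3_sum subst_u3_scale *
    by (simp only: br4_def sum_distrib_left mult_ac)
qed

lemma Aronhold_S_csum:
  "Aronhold_S (csum I p v) =
    9 * (\<Sum>i\<in>I. \<Sum>j\<in>I. \<Sum>k\<in>I. \<Sum>l\<in>I. p i * p j * p k * p l * br4 (v i) (v j) (v k) (v l))"
  unfolding Aronhold_S_def S_uuu_def subst_u3_transvectant_4_csum by (rule refl)

lemma Aronhold_T_csum:
  assumes "Hessian (csum I p v) = csum J q w"
  shows "Aronhold_T (csum I p v) =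
    9 * (\<Sum>i\<in>I. \<Sum>j\<in>I. \<Sum>k\<in>J. \<Sum>l\<in>I. p i * p j * q k * p l * br4 (v i) (v j) (w k) (v l))"
  unfolding Aronhold_T_def T_uuu_def assms subst_u3_transvectant_4_csum by (rule refl)

lemma Hessian_csum:
  "Hessian (csum I p v) = (\<Sum>i\<in>I. \<Sum>j\<in>I. \<Sum>k\<in>I.
    const (18 * p i * p j * p k * br (v i) (v j) (v k) ^ 2) * (lf (v i) * lf (v j) * lf (v k)))"
proof -
  have 12: "const (1 / 12) * (const p * (const (216 * b) * P)) = const (18 * p * b) * P"
    for p b and P :: "complex tpoly"
  proof -
    have "18 * p * b = 1 / 12 * (p * (216 * b))"
      by simp
    then show ?thesis by (simp only: const_mult mult.assoc)
  qed
  have 18: "18 * (p i * p j * p k) * b = 18 * p i * p j * p k * b" for i j k b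
    by (simp only: mult.assoc)
  show ?thesis
    unfolding Hessian_def csum_def transvectant_lincomb transvectant_2_cubes sum_distrib_left 12 18 by (rule refl)
qed

section \<open>Covariance\<close>

text \<open>The matrix with columns \<open>x\<close>, \<open>y\<close>, \<open>z\<close> applied to
  \<open>n\<close>; replacing vectors \<open>n i\<close> by their images is a linear substitution in
  a sum of cubes.\<close>

definition comb :: "(3 \<Rightarrow> complex) \<Rightarrow> (3 \<Rightarrow> complex) \<Rightarrow> (3 \<Rightarrow> complex) \<Rightarrow> (3 \<Rightarrow> complex) \<Rightarrow> 3 \<Rightarrow> complex" where
  "comb x y z n i = n 1 * x i + n 2 * y i + n 3 * z i"

definition vec3 :: "complex \<Rightarrow> complex \<Rightarrow> complex \<Rightarrow> 3 \<Rightarrow> complex" where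
  "vec3 p q r i = (if i = 1 then p else if i = 2 then q else r)"

lemma vec3_simps [simp]: "vec3 p q r 1 = p" "vec3 p q r 2 = q" "vec3 p q r 3 = r"
  by (simp_all add: vec3_def)

lemma br_comb: "br (comb x y z n) (comb x y z m) (comb x y z k) = br x y z * br n m k"
  unfolding br_def comb_def by algebra

lemma br4_comb:
  "br4 (comb x y z a) (comb x y z b) (comb x y z c) (comb x y z d) = br x y z ^ 4 * br4 a b c d"
  unfolding br4_def br_comb by algebra

lemma lf_comb: "lf (comb x y z n) = const (n 1) * lf x + const (n 2) * lf y + const (n 3) * lf z"
  unfolding comb_def[abs_def] lf_add lf_scale ..

lemma lf_ext:
  fixes v :: "3 \<Rightarrow> 'c::comm_ring_1"
  assumes "\<And>i. v i = w i" shows "lf v = lf w"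
  using assms by (simp add: lf_def)

text \<open>The signs of \<open>24 abc = (a+b+c)\<^sup>3 - (a+b-c)\<^sup>3 - (a-b+c)\<^sup>3 - (-a+b+c)\<^sup>3\<close>.\<close>

definition pol :: "nat \<Rightarrow> (3 \<Rightarrow> complex) \<Rightarrow> (3 \<Rightarrow> complex) \<Rightarrow> (3 \<Rightarrow> complex) \<Rightarrow> 3 \<Rightarrow> complex" where
  "pol s a b c = comb a b c ([vec3 1 1 1, vec3 1 1 (-1), vec3 1 (-1) 1, vec3 (-1) 1 1] ! s)"

definition pol_sgn :: "nat \<Rightarrow> complex" where
  "pol_sgn s = [1, -1, -1, -1] ! s"

lemma sum_4: "(\<Sum>s<4. F s) = F 0 + F 1 + F 2 + F (3::nat)"
  for F :: "nat \<Rightarrow> 'a::comm_monoid_add"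
  by (simp add: eval_nat_numeral add.assoc)

text \<open>\<open>Hessian_csum\<close> yields products of three linear forms, whereas
  \<open>Aronhold_T_csum\<close> expects the Hessian as a weighted sum of cubes; polarization
  bridges the two.\<close>

lemma product_eq_cubes:
  "const k * (lf a * lf b * lf c) = (\<Sum>s<4. const (k / 24 * pol_sgn s) * lf (pol s a b c) ^ 3)"
proof -
  have "const (k / 24) * 24 = const k"
    by (simp flip: const_numeral const_mult)
  then have "const k * (lf a * lf b * lf c) = const (k / 24) * (24 * (lf a * lf b * lf c))"
    by (metis mult.assoc)
  also have "24 * (lf a * lf b * lf c) = (lf a + lf b + lf c) ^ 3 - (lf a + lf b - lf c) ^ 3
      - (lf a - lf b + lf c) ^ 3 - (- lf a + lf b + lf c) ^ 3"
    by algebra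
  finally show ?thesis
    unfolding sum_4 by (simp add: pol_sgn_def pol_def lf_comb const_minus right_diff_distrib)
qed

lemma pol_comb: "pol s (comb x y z a) (comb x y z b) (comb x y z c) = comb x y z (pol s a b c)"
  by (rule ext) (simp add: pol_def comb_def algebra_simps)

lemma Hessian_csum_cubes:
  "Hessian (csum I p v) = csum (I \<times> I \<times> I \<times> {..<4})
    (\<lambda>(i, j, k, s). 18 * p i * p j * p k * br (v i) (v j) (v k) ^ 2 / 24 * pol_sgn s)
    (\<lambda>(i, j, k, s). pol s (v i) (v j) (v k))"
  unfolding Hessian_csum product_eq_cubes
  unfolding csum_def sum.cartesian_product by (intro sum.cong) auto

text \<open>Every summand contains four brackets, and each contributes one determinant.\<close>

lemma Aronhold_S_comb:
  "Aronhold_S (csum I p (\<lambda>i. comb x y z (n i))) = br x y z ^ 4 * Aronhold_S (csum I p n)"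
  unfolding Aronhold_S_csum br4_comb by (simp only: sum_distrib_left mult_ac)

lemma Aronhold_T_csum_cubes:
  "Aronhold_T (csum I p v) = 9 * (\<Sum>i\<in>I. \<Sum>j\<in>I.
    \<Sum>(k, k', k'', s)\<in>I \<times> I \<times> I \<times> {..<4}. \<Sum>l\<in>I.
      p i * p j * (18 * p k * p k' * p k'' * br (v k) (v k') (v k'') ^ 2 / 24 * pol_sgn s) * p l
      * br4 (v i) (v j) (pol s (v k) (v k') (v k'')) (v l))"
  unfolding Aronhold_T_csum[OF Hessian_csum_cubes] by (simp only: case_prod_beta')

text \<open>Four determinants come from \<open>br4\<close> and two from the squared bracket in the
  Hessian; \<open>pol\<close> commutes with the substitution.\<close>

lemma Aronhold_T_comb:
  "Aronhold_T (csum I p (\<lambda>i. comb x y z (n i))) = br x y z ^ 6 * Aronhold_T (csum I p n)"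
proof -
  have *: "a * (18 * b * (D * c) ^ 2 / 24 * d) * e * (D ^ 4 * f) = D ^ 6 * (a * (18 * b * c ^ 2 / 24 * d) * e * f)"
    for a b c d e f D :: complex
    by (simp add: field_simps power2_eq_square eval_nat_numeral)
  have **: "18 * p k * p k' * p k'' = 18 * (p k * p k' * p k'')" for k k' k''
    by simp
  show ?thesis
    unfolding Aronhold_T_csum_cubes br4_comb br_comb pol_comb ** *
    by (simp only: sum_distrib_left case_prod_beta mult.left_commute[of 9])
qed

text \<open>For fixed vectors, T is a polynomial in the weights.\<close>

lemma Aronhold_T_tendsto:
  assumes "\<And>i. i \<in> I \<Longrightarrow> ((\<lambda>t. p t i) \<longlongrightarrow> q i) F"
  shows "((\<lambda>t. Aronhold_T (csum I (p t) v)) \<longlongrightarrow> Aronhold_T (csum I q v)) F"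
  unfolding Aronhold_T_csum_cubes
  by (intro tendsto_intros tendsto_sum) (auto intro!: tendsto_intros tendsto_sum assms)

lemma br_eq_0_repeat [simp]: "br a a b = 0" "br a b a = 0" "br b a a = 0"
  by (simp_all add: br_def)

text \<open>Among fewer than three vectors every bracket repeats an argument, so the Hessian is
  zero, which is the empty sum of cubes. This gives the lower bound for the rank.\<close>

lemma Aronhold_T_csum_lt_3:
  assumes "r < 3"
  shows "Aronhold_T (csum {..<r::nat} p v) = 0"
proof -
  have "br (v i) (v j) (v k) = 0" if "i < r" "j < r" "k < r" for i j k
  proof -
    have "i = j \<or> j = k \<or> i = k" using that assms by linarith
    then show ?thesis by auto
  qed
  then have "Hessian (csum {..<r} p v) = 0"
    unfolding Hessian_csum by (intro sum.neutral ballI) simp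
  then have "Hessian (csum {..<r} p v) = csum {} p v"
    by (simp add: csum_def)
  from Aronhold_T_csum[OF this] show ?thesis by simp
qed

section \<open>Normal forms\<close>

lemma const_divide_numeral: "const c = numeral n * const (c / numeral n)" for c :: complex
  by (simp flip: const_numeral const_mult)

lemma const_half: "const c = 2 * const (c / 2)" for c :: complex
  by (rule const_divide_numeral)

section \<open>The Fermat cubic\<close>

definition unit_vec :: "nat \<Rightarrow> 3 \<Rightarrow> complex" where
  "unit_vec i = [vec3 1 0 0, vec3 0 1 0, vec3 0 0 1] ! i"

lemma sum_lessThan_3: "(\<Sum>s<3. F s) = F 0 + F 1 + F (2::nat)"
  for F :: "nat \<Rightarrow> 'a::comm_monoid_add"
  by (simp add: eval_nat_numeral add.assoc)

lemma fermat_eq_csum: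
  "lf a ^ 3 + lf b ^ 3 + lf c ^ 3 = csum {..<3} (\<lambda>_. 1) (\<lambda>i. comb a b c (unit_vec i))"
  by (simp add: csum_def sum_lessThan_3 lf_comb unit_vec_def)

lemma br_unit_vec: "br (unit_vec 0) (unit_vec 1) (unit_vec 2) = 1" "br (unit_vec 1) (unit_vec 2) (unit_vec 0) = 1" "br (unit_vec 2) (unit_vec 0) (unit_vec 1) = 1"
  "br (unit_vec 0) (unit_vec 2) (unit_vec 1) = -1" "br (unit_vec 1) (unit_vec 0) (unit_vec 2) = -1" "br (unit_vec 2) (unit_vec 1) (unit_vec 0) = -1"
  by (simp_all add: unit_vec_def br_def)

text \<open>In \<open>br4\<close> the first bracket needs three distinct unit vectors; the fourth
  vector then equals one of them and makes another bracket vanish.\<close>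

lemma Aronhold_S_fermat: "Aronhold_S (lf a ^ 3 + lf b ^ 3 + lf c ^ 3) = 0"
  unfolding fermat_eq_csum Aronhold_S_comb
  by (simp add: Aronhold_S_csum sum_lessThan_3 br4_def)

lemma Hessian_unit_vec: "Hessian (csum {..<3} (\<lambda>_. 1) unit_vec) =
    csum {..<4} (\<lambda>s. 108 / 24 * pol_sgn s) (\<lambda>s. pol s (unit_vec 0) (unit_vec 1) (unit_vec 2))"
proof -
  \<comment> \<open>Six orderings of the three vectors, each with squared bracket 1 and coefficient
    18.\<close>
  have "Hessian (csum {..<3} (\<lambda>_. 1) unit_vec) = const 108 * (lf (unit_vec 0) * lf (unit_vec 1) * lf (unit_vec 2))"
    unfolding Hessian_csum sum_lessThan_3 br_unit_vec br_eq_0_repeat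
    by (simp add: algebra_simps del: One_nat_def)
  then show ?thesis
    by (simp only: product_eq_cubes csum_def)
qed

lemma Aronhold_T_fermat: "Aronhold_T (lf a ^ 3 + lf b ^ 3 + lf c ^ 3) = 972 * br a b c ^ 6"
proof -
  have "Aronhold_T (csum {..<3} (\<lambda>_. 1) unit_vec) = 972"
    unfolding Aronhold_T_csum[OF Hessian_unit_vec] sum_4 sum_lessThan_3 br4_def br_unit_vec br_eq_0_repeat
    by (simp add: pol_def unit_vec_def comb_def br_def pol_sgn_def)
  then show ?thesis
    unfolding fermat_eq_csum Aronhold_T_comb by simp
qed

section \<open>Cubics without monomials divisible by xy\<close>

definition split_vec :: "nat \<Rightarrow> 3 \<Rightarrow> complex" where
  "split_vec i = [vec3 1 0 0, vec3 1 0 1, vec3 1 0 (-1), vec3 0 1 0, vec3 0 1 1, vec3 0 1 (-1), vec3 0 0 1] ! i"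

lemma sum_7: "(\<Sum>s<7. F s) = F 0 + F 1 + F 2 + F 3 + F 4 + F 5 + F (6::nat)"
  for F :: "nat \<Rightarrow> 'a::comm_monoid_add"
  by (simp add: eval_nat_numeral add.assoc)

lemma Aronhold_S_split_vec:
  "Aronhold_S (csum {..<7} p split_vec) =
    - 216 * (p 0 * p 1 + p 0 * p 2 + 4 * p 1 * p 2) * (p 3 * p 4 + p 3 * p 5 + 4 * p 4 * p 5)"
proof -
  \<comment> \<open>The innermost sum stays folded until the triples with zero bracket have been
    simplified away, which keeps the expansion small.\<close>
  define G where "G i j k = (\<Sum>l<7. p l * (br (split_vec l) (split_vec j) (split_vec k) * br (split_vec i) (split_vec l) (split_vec k) * br (split_vec i) (split_vec j) (split_vec l)))" for i j k
  have "Aronhold_S (csum {..<7} p split_vec) = 9 * (\<Sum>i<7. \<Sum>j<7. \<Sum>k<7. p i * p j * p k * (br (split_vec i) (split_vec j) (split_vec k) * G i j k))"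
    unfolding Aronhold_S_csum G_def br4_def by (simp only: sum_distrib_left mult_ac)
  also have "\<dots> = - 216 * (p 0 * p 1 + p 0 * p 2 + 4 * p 1 * p 2) * (p 3 * p 4 + p 3 * p 5 + 4 * p 4 * p 5)"
    unfolding sum_7
    by (simp add: split_vec_def br_def) (simp add: G_def sum_7 split_vec_def br_def, algebra)
  finally show ?thesis .
qed

text \<open>Cubics whose mixed polar at the first two coordinate points vanishes.\<close>

definition split_cubic :: "complex \<Rightarrow> complex \<Rightarrow> complex \<Rightarrow> complex \<Rightarrow> complex \<Rightarrow> complex \<Rightarrow> complex \<Rightarrow>
    (3 \<Rightarrow> complex) \<Rightarrow> (3 \<Rightarrow> complex) \<Rightarrow> (3 \<Rightarrow> complex) \<Rightarrow> complex tpoly" where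
  "split_cubic a d h b e g c x y z =
     const a * lf x ^ 3 + 3 * const d * lf x ^ 2 * lf z + 3 * const h * lf x * lf z ^ 2 +
     const b * lf y ^ 3 + 3 * const e * lf y ^ 2 * lf z + 3 * const g * lf y * lf z ^ 2 +
     const c * lf z ^ 3"

text \<open>Weights (h + d)/2 and (h - d)/2 on the cubes of x + z and x - z produce h x^3 + 3d x^2 z
  + 3h x z^2 + d z^3. The excess h and d is subtracted from the weights of x^3 and z^3; likewise for
  y with g and e.\<close>

definition split_coeff :: "complex \<Rightarrow> complex \<Rightarrow> complex \<Rightarrow> complex \<Rightarrow> complex \<Rightarrow> complex \<Rightarrow> complex \<Rightarrow> nat \<Rightarrow> complex" where
  "split_coeff a d h b e g c i =
     [a - h, (h + d) / 2, (h - d) / 2, b - g, (g + e) / 2, (g - e) / 2, c - d - e] ! i"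

lemma split_cubic_eq_csum:
  "split_cubic a d h b e g c x y z = csum {..<7} (split_coeff a d h b e g c) (\<lambda>i. comb x y z (split_vec i))"
  unfolding csum_def sum_7 split_cubic_def
    const_half[of d] const_half[of h] const_half[of e] const_half[of g]
  by (simp add: split_coeff_def lf_comb split_vec_def add_divide_distrib diff_divide_distrib const_add
      const_diff const_minus const_half[of d] const_half[of h] const_half[of e] const_half[of g] del: const_1)
     algebra

text \<open>With these weights the first factor of \<open>Aronhold_S_split_vec\<close> is (a - h) h
  + h^2 - d^2 = a h - d^2, up to sign the discriminant of the polar a x^2 + 2d x z + h z^2; the
  second is its analogue in y and z.\<close>

lemma Aronhold_S_split_cubic:
  "Aronhold_S (split_cubic a d h b e g c x y z) = - 216 * br x y z ^ 4 * (a * h - d ^ 2) * (b * g - e ^ 2)"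
  unfolding split_cubic_eq_csum Aronhold_S_comb Aronhold_S_split_vec
  by (simp add: split_coeff_def field_simps power2_eq_square)

text \<open>A one-parameter subgroup of determinant one scales every coefficient by a positive power of \<open>s\<close>;
  the invariant is constant along it and therefore equals its value at the zero form.\<close>

lemma Aronhold_T_nullform:
  "Aronhold_T (split_cubic 0 0 h b e g c x y z) = 0"
proof -
  \<comment> \<open>Scaling x, y, z with weights 4, -1, -3, of sum zero, gives x z^2, y^3, y^2 z, y
    z^2, z^3 the exponents 2, 3, 5, 7, 9. The absent x^3 and x^2 z would get negative ones.\<close>
  define q where "q s = split_coeff 0 0 (s ^ 2 * h) (s ^ 3 * b) (s ^ 5 * e) (s ^ 7 * g) (s ^ 9 * c)" for s
  have inv: "Aronhold_T (csum {..<7} (q s) split_vec) = Aronhold_T (csum {..<7} (q 1) split_vec)" if "s \<noteq> 0" for s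
  proof -
    define x' y' z' where "x' = vec3 (s ^ 4) 0 0" "y' = vec3 0 (1 / s) 0" "z' = vec3 0 0 (1 / s ^ 3)"
    note vecs = x'_y'_z'_def
    have lf_s: "lf x' = const (s ^ 4) * lf (unit_vec 0)" "lf (unit_vec 1) = const s * lf y'" "lf (unit_vec 2) = const (s ^ 3) * lf z'"
      using that unfolding lf_scale[symmetric]
      by (auto intro!: lf_ext simp: vecs unit_vec_def vec3_def)
    have comb_unit_vec: "comb (unit_vec 0) (unit_vec 1) (unit_vec 2) n = n" for n
    proof
      fix i :: 3
      show "comb (unit_vec 0) (unit_vec 1) (unit_vec 2) n i = n i"
        using exhaust_3[of i] by (auto simp: comb_def unit_vec_def)
    qed
    have "csum {..<7} (q 1) split_vec = split_cubic 0 0 h b e g c (unit_vec 0) (unit_vec 1) (unit_vec 2)"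
      by (simp add: q_def split_cubic_eq_csum comb_unit_vec del: One_nat_def)
    also have "\<dots> = split_cubic 0 0 (s ^ 2 * h) (s ^ 3 * b) (s ^ 5 * e) (s ^ 7 * g) (s ^ 9 * c) x' y' z'"
      unfolding split_cubic_def lf_s const_hom const_0 by algebra
    also have "\<dots> = csum {..<7} (q s) (\<lambda>i. comb x' y' z' (split_vec i))"
      by (simp add: q_def split_cubic_eq_csum)
    finally have "Aronhold_T (csum {..<7} (q 1) split_vec) = br x' y' z' ^ 6 * Aronhold_T (csum {..<7} (q s) split_vec)"
      by (simp add: Aronhold_T_comb)
    moreover have "br x' y' z' = 1"
      using that by (simp add: vecs br_def field_simps eval_nat_numeral)
    ultimately show ?thesis by simp
  qed
  have "((\<lambda>s. q s i) \<longlongrightarrow> 0) (at 0)" if "i \<in> {..<7}" for i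
  proof -
    have "i \<in> {0, 1, 2, 3, 4, 5, 6}" using that by auto
    then show ?thesis
      unfolding q_def split_coeff_def by (auto intro!: tendsto_eq_intros)
  qed
  then have "((\<lambda>s. Aronhold_T (csum {..<7} (q s) split_vec)) \<longlongrightarrow> Aronhold_T (csum {..<7} (\<lambda>_. 0) split_vec)) (at 0)"
    by (rule Aronhold_T_tendsto)
  moreover have "((\<lambda>s. Aronhold_T (csum {..<7} (q s) split_vec)) \<longlongrightarrow> Aronhold_T (csum {..<7} (q 1) split_vec)) (at 0)"
    by (rule tendsto_eventually, unfold eventually_at_filter, rule always_eventually) (use inv in blast)
  moreover have "Aronhold_T (csum {..<7} (\<lambda>_. 0) split_vec) = 0"
    by (simp add: Aronhold_T_csum_cubes)
  ultimately have "Aronhold_T (csum {..<7} (q 1) split_vec) = 0"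
    using tendsto_unique[OF at_neq_bot] by metis
  then show ?thesis
    unfolding split_cubic_eq_csum Aronhold_T_comb by (simp add: q_def)
qed

section \<open>The nodal cubic\<close>

definition nodal_vec :: "nat \<Rightarrow> 3 \<Rightarrow> complex" where
  "nodal_vec i = [vec3 0 1 0, vec3 0 0 1, vec3 1 1 1, vec3 1 1 (-1), vec3 1 (-1) 1, vec3 (-1) 1 1] ! i"

lemma sum_6: "(\<Sum>s<6. F s) = F 0 + F 1 + F 2 + F 3 + F 4 + F (5::nat)"
  for F :: "nat \<Rightarrow> 'a::comm_monoid_add"
  by (simp add: eval_nat_numeral add.assoc)

lemma Aronhold_S_nodal:
  "Aronhold_S (const b * lf y ^ 3 + const c * lf z ^ 3 + 6 * const m * lf x * lf y * lf z) =
    - 216 * br x y z ^ 4 * m ^ 4"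
proof -
  \<comment> \<open>Polarizing 6m xyz into four cubes gives weights of absolute value 6m/24 =
    m/4.\<close>
  define p where "p i = [b, c, m / 4, - m / 4, - m / 4, - m / 4] ! i" for i
  have "const b * lf y ^ 3 + const c * lf z ^ 3 + 6 * const m * lf x * lf y * lf z =
      csum {..<6} p (\<lambda>i. comb x y z (nodal_vec i))"
    unfolding csum_def sum_6
    by (simp add: p_def lf_comb nodal_vec_def const_minus const_divide_numeral[of m "num.Bit0 (num.Bit0 num.One)"])
      algebra
  moreover have "Aronhold_S (csum {..<6} p nodal_vec) = - 216 * m ^ 4"
  proof -
    define G where "G i j k = (\<Sum>l<6. p l * (br (nodal_vec l) (nodal_vec j) (nodal_vec k) * br (nodal_vec i) (nodal_vec l) (nodal_vec k) * br (nodal_vec i) (nodal_vec j) (nodal_vec l)))" for i j k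
    have "Aronhold_S (csum {..<6} p nodal_vec) = 9 * (\<Sum>i<6. \<Sum>j<6. \<Sum>k<6. p i * p j * p k * (br (nodal_vec i) (nodal_vec j) (nodal_vec k) * G i j k))"
      unfolding Aronhold_S_csum G_def br4_def by (simp only: sum_distrib_left mult_ac)
    also have "\<dots> = - 216 * m ^ 4"
      unfolding sum_6
      by (simp add: nodal_vec_def br_def) (simp add: G_def sum_6 nodal_vec_def br_def p_def, simp add: field_simps eval_nat_numeral)
    finally show ?thesis .
  qed
  ultimately show ?thesis
    by (simp add: Aronhold_S_comb)
qed

section \<open>Linear algebra in three variables\<close>

lemma lf_inject [simp]: "lf v = lf w \<longleftrightarrow> v = w" for v w :: "3 \<Rightarrow> complex"
proof
  assume *: "lf v = lf w"
  have "lookup (lf u) (mon 1 0 0) = u 1" "lookup (lf u) (mon 0 1 0) = u 2" "lookup (lf u) (mon 0 0 1) = u 3"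
    for u :: "3 \<Rightarrow> complex"
    by (simp_all add: lf_mon lookup_add lookup_single)
  note this[of v] this[of w]
  then have "v 1 = w 1" "v 2 = w 2" "v 3 = w 3"
    unfolding * by simp_all
  then have "v i = w i" for i
    using exhaust_3[of i] by auto
  then show "v = w" by (rule ext)
qed simp

lemma lf_zero: "lf (\<lambda>_. 0) = 0"
  by (simp add: lf_def)

lemma br_eq_0_imp_kernel:
  fixes a b c :: "3 \<Rightarrow> complex"
  assumes "br a b c = 0"
  obtains n where "n \<noteq> (\<lambda>_. 0)" "comb a b c n = (\<lambda>_. 0)"
proof -
  let ?M = "(\<chi> i j. if j = 1 then a i else if j = 2 then b i else c i) :: complex^3^3"
  have "det ?M = br a b c"
    by (simp add: det_3 br_def algebra_simps)
  then have "\<not> invertible ?M"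
    using assms by (simp add: invertible_det_nz)
  then obtain x where x: "?M *v x = 0" "x \<noteq> 0"
    unfolding invertible_left_inverse matrix_left_invertible_ker by blast
  show ?thesis
  proof
    show "(\<lambda>i. x $ i) \<noteq> (\<lambda>_. 0)"
    proof
      assume *: "(\<lambda>i. x $ i) = (\<lambda>_. 0)"
      have "x $ i = 0" for i
        using fun_cong[OF *, of i] .
      then show False using x(2) by (simp add: vec_eq_iff)
    qed
    show "comb a b c (\<lambda>i. x $ i) = (\<lambda>_. 0)"
    proof
      fix i
      have "(?M *v x) $ i = 0" using x(1) by simp
      then show "comb a b c (\<lambda>i. x $ i) i = 0"
        by (simp add: comb_def matrix_vector_mult_def sum_3 mult.commute)
    qed
  qed
qed

lemma br_neq_0_imp_comb_0:
  assumes "br a b c \<noteq> 0" "comb a b c n = (\<lambda>_. 0)"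
  shows "n i = 0"
proof -
  have 0: "comb a b c n i = 0" for i
    by (simp add: assms(2))
  \<comment> \<open>Cramer's rule.\<close>
  have "n 1 * br a b c = br (comb a b c n) b c" "n 2 * br a b c = br a (comb a b c n) c"
    "n 3 * br a b c = br a b (comb a b c n)"
    unfolding br_def comb_def by algebra+
  with assms(1) 0 have "n 1 = 0" "n 2 = 0" "n 3 = 0"
    by (simp_all add: br_def)
  then show ?thesis using exhaust_3[of i] by auto
qed

text \<open>Independence refers to a set, in which equal forms would collapse to one. Distinctness
  rules this out and makes it possible to assign a coefficient to each form.\<close>

lemma distinct_independent_iff_br:
  fixes a b c :: "3 \<Rightarrow> complex"
  shows "distinct [lf a, lf b, lf c] \<and> tpoly.independent {lf a, lf b, lf c} \<longleftrightarrow> br a b c \<noteq> 0"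
proof
  assume *: "distinct [lf a, lf b, lf c] \<and> tpoly.independent {lf a, lf b, lf c}"
  show "br a b c \<noteq> 0"
  proof
    assume "br a b c = 0"
    then obtain n where n: "n \<noteq> (\<lambda>_. 0)" "comb a b c n = (\<lambda>_. 0)"
      by (rule br_eq_0_imp_kernel)
    define u where "u p = (if p = lf a then n 1 else if p = lf b then n 2 else n 3)" for p
    have "(\<Sum>p\<in>{lf a, lf b, lf c}. const (u p) * p) = 0"
      using * lf_comb[of a b c n] by (auto simp: u_def n(2) lf_zero add.assoc)
    then have "\<forall>p\<in>{lf a, lf b, lf c}. u p = 0"
      using * tpoly.independentD[of "{lf a, lf b, lf c}" "{lf a, lf b, lf c}" u] by blast
    then have "n 1 = 0" "n 2 = 0" "n 3 = 0"
      using * by (auto simp: u_def split: if_splits)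
    then have "n i = 0" for i
      using exhaust_3[of i] by auto
    then show False using n(1) by auto
  qed
next
  assume br: "br a b c \<noteq> 0"
  then have d: "distinct [lf a, lf b, lf c]" by auto
  moreover have "tpoly.independent {lf a, lf b, lf c}"
  proof (rule tpoly.independent_if_scalars_zero)
    fix u p
    assume 0: "(\<Sum>p\<in>{lf a, lf b, lf c}. const (u p) * p) = 0" and p: "p \<in> {lf a, lf b, lf c}"
    let ?n = "vec3 (u (lf a)) (u (lf b)) (u (lf c))"
    have "lf (comb a b c ?n) = lf (\<lambda>_. 0)"
      using 0 d by (simp add: lf_comb lf_zero add.assoc)
    then have "comb a b c ?n = (\<lambda>_. 0)" by simp
    from br_neq_0_imp_comb_0[OF br this, of 1] br_neq_0_imp_comb_0[OF br this, of 2]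
      br_neq_0_imp_comb_0[OF br this, of 3] p
    show "u p = 0" by auto
  qed simp
  ultimately show "distinct [lf a, lf b, lf c] \<and> tpoly.independent {lf a, lf b, lf c}" ..
qed

text \<open>If the bracket vanishes for every third vector, the unit vectors show that the cross
  product of \<open>p\<close> and \<open>q\<close> is zero, so \<open>q\<close> is proportional to
  \<open>p\<close>.\<close>

lemma exists_complement:
  fixes p q :: "3 \<Rightarrow> complex"
  assumes "p \<noteq> (\<lambda>_. 0)"
  obtains (complement) r where "br p q r \<noteq> 0" | (dependent) k where "q = (\<lambda>i. k * p i)"
proof (cases "\<exists>r. br p q r \<noteq> 0")
  case False
  then have 0: "br p q r = 0" for r by blast
  have m: "p 2 * q 3 = p 3 * q 2" "p 3 * q 1 = p 1 * q 3" "p 1 * q 2 = p 2 * q 1"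
    using 0[of "vec3 1 0 0"] 0[of "vec3 0 1 0"] 0[of "vec3 0 0 1"] by (simp_all add: br_def)
  obtain j where j: "p j \<noteq> 0" using assms by auto
  have "q i = q j / p j * p i" for i
    using exhaust_3[of i] exhaust_3[of j] j m by (auto simp: field_simps)
  then show ?thesis using dependent by blast
qed (use complement in blast)

lemma exists_basis_extension:
  fixes p :: "3 \<Rightarrow> complex"
  assumes "p \<noteq> (\<lambda>_. 0)"
  obtains q r where "br p q r \<noteq> 0"
proof -
  obtain j where j: "p j \<noteq> 0" using assms by auto
  have "br p (vec3 0 1 0) (vec3 0 0 1) = p 1" "br p (vec3 0 0 1) (vec3 1 0 0) = p 2"
    "br p (vec3 1 0 0) (vec3 0 1 0) = p 3"
    by (simp_all add: br_def)
  moreover have "j = 1 \<or> j = 2 \<or> j = 3" by (rule exhaust_3)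
  ultimately show ?thesis
    using j that[of "vec3 0 1 0" "vec3 0 0 1"] that[of "vec3 0 0 1" "vec3 1 0 0"]
      that[of "vec3 1 0 0" "vec3 0 1 0"] by (elim disjE) auto
qed

text \<open>Expands the generic point in the basis \<open>g1\<close>, \<open>g2\<close>,
  \<open>g3\<close>. The coordinate forms are rows of the inverse matrix, that is, cross products
  divided by the determinant.\<close>

lemma dual_basis:
  fixes g1 g2 g3 :: "3 \<Rightarrow> complex"
  assumes D: "br g1 g2 g3 \<noteq> 0"
  obtains x y z where "br x y z \<noteq> 0"
    "\<And>i. var i = const (g1 i) * lf x + const (g2 i) * lf y + const (g3 i) * lf z"
proof -
  let ?D = "br g1 g2 g3"
  define x y z where "x i = cross g2 g3 i / ?D" and "y i = cross g3 g1 i / ?D" and "z i = cross g1 g2 i / ?D" for i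
  have cross: "cross u v 1 = u 2 * v 3 - u 3 * v 2" "cross u v 2 = u 3 * v 1 - u 1 * v 3"
    "cross u v 3 = u 1 * v 2 - u 2 * v 1" for u v
    by (simp_all add: cross_def)
  \<comment> \<open>The determinant of the adjugate is the square of the determinant, so
    \<open>br x y z\<close> is the inverse of \<open>?D\<close>.\<close>
  have "br x y z * ?D ^ 3 = br (cross g2 g3) (cross g3 g1) (cross g1 g2)"
    using D by (simp add: x_def y_def z_def br_def[of x] br_def[of "cross g2 g3"] field_simps eval_nat_numeral)
  also have "\<dots> = ?D ^ 2"
    unfolding br_def cross by algebra
  finally have "br x y z \<noteq> 0" using D by auto
  moreover have "var i = const (g1 i) * lf x + const (g2 i) * lf y + const (g3 i) * lf z" for i
  proof -
    have dual: "g1 i * x j + g2 i * y j + g3 i * z j = (if i = j then 1 else 0)" for i j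
    proof -
      have "g1 i * cross g2 g3 j + g2 i * cross g3 g1 j + g3 i * cross g1 g2 j = (if i = j then ?D else 0)"
        using exhaust_3[of i] exhaust_3[of j] by (auto simp: cross br_def algebra_simps)
      then have "(g1 i * cross g2 g3 j + g2 i * cross g3 g1 j + g3 i * cross g1 g2 j) / ?D = (if i = j then 1 else 0)"
        using D by simp
      then show ?thesis by (simp add: x_def y_def z_def add_divide_distrib)
    qed
    have "const (g1 i) * lf x + const (g2 i) * lf y + const (g3 i) * lf z =
        lf (\<lambda>j. g1 i * x j + g2 i * y j + g3 i * z j)"
      by (simp only: lf_add lf_scale)
    also have "\<dots> = var i"
    proof -
      have "lf (\<lambda>j. if i = j then 1 else 0) = (\<Sum>j\<in>UNIV. if j = i then var j else 0 :: complex tpoly)"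
        unfolding lf_def by (intro sum.cong) auto
      then show ?thesis unfolding dual by simp
    qed
    finally show ?thesis by (rule sym)
  qed
  ultimately show ?thesis by (rule that)
qed

section \<open>The polar form of a cubic\<close>

text \<open>The trilinear form with coefficient tensor \<open>A\<close>. The ring is left general
  because the arguments are complex vectors as well as the generic point \<open>var\<close>.\<close>

definition polar :: "(3 \<Rightarrow> 3 \<Rightarrow> 3 \<Rightarrow> 'c) \<Rightarrow> (3 \<Rightarrow> 'c) \<Rightarrow> (3 \<Rightarrow> 'c) \<Rightarrow> (3 \<Rightarrow> 'c) \<Rightarrow> 'c::comm_ring_1" where
  "polar A u v w = (\<Sum>i\<in>UNIV. \<Sum>j\<in>UNIV. \<Sum>k\<in>UNIV. A i j k * (u i * v j * w k))"

definition symmetric3 :: "(3 \<Rightarrow> 3 \<Rightarrow> 3 \<Rightarrow> 'c) \<Rightarrow> bool" where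
  "symmetric3 A \<longleftrightarrow> (\<forall>i j k. A i j k = A j i k \<and> A i j k = A i k j)"

lemma polar_swap12:
  assumes "symmetric3 A" shows "polar A u v w = polar A v u w"
proof -
  have A: "A i j k = A j i k" for i j k using assms by (simp add: symmetric3_def)
  have "polar A v u w = (\<Sum>j\<in>UNIV. \<Sum>i\<in>UNIV. \<Sum>k\<in>UNIV. A i j k * (v i * u j * w k))"
    unfolding polar_def by (rule sum.swap)
  also have "\<dots> = polar A u v w"
    unfolding polar_def by (intro sum.cong refl, subst A, simp only: mult_ac)
  finally show ?thesis by (rule sym)
qed

lemma polar_swap23:
  assumes "symmetric3 A" shows "polar A u v w = polar A u w v"
proof -
  have A: "A i j k = A i k j" for i j k using assms by (simp add: symmetric3_def)
  have "polar A u w v = (\<Sum>i\<in>UNIV. \<Sum>k\<in>UNIV. \<Sum>j\<in>UNIV. A i j k * (u i * w j * v k))"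
    unfolding polar_def by (rule sum.cong[OF refl], rule sum.swap)
  also have "\<dots> = polar A u v w"
    unfolding polar_def by (intro sum.cong refl, subst A, simp only: mult_ac)
  finally show ?thesis by (rule sym)
qed

lemma polar_lincomb1:
  "polar A (\<lambda>i. a i * x + b i * y + c i * z) v w = x * polar A a v w + y * polar A b v w + z * polar A c v w"
  unfolding polar_def sum_distrib_left sum.distrib[symmetric]
  by (intro sum.cong refl) (simp only: ring_distribs mult_ac)

lemma polar_lincomb2:
  assumes "symmetric3 A"
  shows "polar A u (\<lambda>i. a i * x + b i * y + c i * z) w = x * polar A u a w + y * polar A u b w + z * polar A u c w"
  using polar_lincomb1[of A a x b y c z u w] by (simp only: polar_swap12[OF assms, of u])

lemma polar_lincomb3:
  assumes "symmetric3 A"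
  shows "polar A u v (\<lambda>i. a i * x + b i * y + c i * z) = x * polar A u v a + y * polar A u v b + z * polar A u v c"
  using polar_lincomb2[OF assms, of u a x b y c z v] by (simp only: polar_swap23[OF assms, of u v])

lemma polar_const:
  "polar (\<lambda>i j k. const (A i j k)) (\<lambda>i. const (u i)) (\<lambda>i. const (v i)) (\<lambda>i. const (w i)) =
    const (polar A u v w)"
  by (simp only: polar_def const_sum const_mult)

lemma is_form_3_polar:
  fixes f :: "complex tpoly"
  assumes "is_form 3 f"
  obtains A where "symmetric3 A" "f = polar (\<lambda>i j k. const (A i j k)) var var var"
proof -
  \<comment> \<open>Each coefficient is divided by the number of orderings of its monomial, since
    the sum over all index triples counts every ordering.\<close>
  define co where "co m = (\<Prod>i\<in>UNIV. fact (lookup m i)) / 6 * lookup f m" for m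
  define A where "A i j k = co (single i 1 + single j 1 + single k 1)" for i j k
  have [simp]: "single 1 1 = mon 1 0 0" "single 2 1 = mon 0 1 0" "single 3 1 = mon 0 0 1"
    by (simp_all add: mon_def)
  have co: "co (mon a b c) = fact a * fact b * fact c / 6 * lookup f (mon a b c)" for a b c
    by (simp add: co_def prod_3 lookup_mon)
  have co': "const (lookup f (mon 3 0 0)) = const (co (mon 3 0 0))"
    "const (lookup f (mon 0 3 0)) = const (co (mon 0 3 0))"
    "const (lookup f (mon 0 0 3)) = const (co (mon 0 0 3))"
    "const (lookup f (mon 2 1 0)) = 3 * const (co (mon 2 1 0))"
    "const (lookup f (mon 2 0 1)) = 3 * const (co (mon 2 0 1))"
    "const (lookup f (mon 1 2 0)) = 3 * const (co (mon 1 2 0))"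
    "const (lookup f (mon 0 2 1)) = 3 * const (co (mon 0 2 1))"
    "const (lookup f (mon 1 0 2)) = 3 * const (co (mon 1 0 2))"
    "const (lookup f (mon 0 1 2)) = 3 * const (co (mon 0 1 2))"
    "const (lookup f (mon 1 1 1)) = 6 * const (co (mon 1 1 1))"
    by (simp_all add: co fact_numeral flip: const_numeral const_mult)
  have "symmetric3 A"
    unfolding symmetric3_def A_def by (simp add: add_ac)
  moreover have "f = polar (\<lambda>i j k. const (A i j k)) var var var"
  proof -
    have n: "Suc (Suc 0) = 2" "Suc (Suc (Suc 0)) = 3" by simp_all
    have A: "A 1 1 1 = co (mon 3 0 0)" "A 2 2 2 = co (mon 0 3 0)" "A 3 3 3 = co (mon 0 0 3)"
      "A 1 1 2 = co (mon 2 1 0)" "A 1 2 1 = co (mon 2 1 0)" "A 2 1 1 = co (mon 2 1 0)"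
      "A 1 1 3 = co (mon 2 0 1)" "A 1 3 1 = co (mon 2 0 1)" "A 3 1 1 = co (mon 2 0 1)"
      "A 1 2 2 = co (mon 1 2 0)" "A 2 2 1 = co (mon 1 2 0)" "A 2 1 2 = co (mon 1 2 0)"
      "A 3 2 2 = co (mon 0 2 1)" "A 2 2 3 = co (mon 0 2 1)" "A 2 3 2 = co (mon 0 2 1)"
      "A 1 3 3 = co (mon 1 0 2)" "A 3 3 1 = co (mon 1 0 2)" "A 3 1 3 = co (mon 1 0 2)"
      "A 2 3 3 = co (mon 0 1 2)" "A 3 3 2 = co (mon 0 1 2)" "A 3 2 3 = co (mon 0 1 2)"
      "A 1 2 3 = co (mon 1 1 1)" "A 1 3 2 = co (mon 1 1 1)" "A 2 1 3 = co (mon 1 1 1)"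
      "A 2 3 1 = co (mon 1 1 1)" "A 3 1 2 = co (mon 1 1 1)" "A 3 2 1 = co (mon 1 1 1)"
      by (simp_all add: A_def mon_add n del: One_nat_def)
    show ?thesis
      using is_form_3_expand[OF assms] unfolding polar_def sum_3 A co' by algebra
  qed
  ultimately show ?thesis by (rule that)
qed

text \<open>Inserting the expansion of the generic point in the basis \<open>p\<close>,
  \<open>q\<close>, \<open>r\<close> makes the values of the polar form on basis vectors the
  coefficients of \<open>f\<close>, with multinomial factors.\<close>

lemma polar_basis:
  fixes f :: "complex tpoly"
  assumes A: "symmetric3 A" and f: "f = polar (\<lambda>i j k. const (A i j k)) var var var"
    and D: "br p q r \<noteq> 0"
  obtains x y z where "br x y z \<noteq> 0"
    "f = const (polar A p p p) * lf x ^ 3 + const (polar A q q q) * lf y ^ 3 + const (polar A r r r) * lf z ^ 3 +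
       3 * const (polar A p p q) * lf x ^ 2 * lf y + 3 * const (polar A p p r) * lf x ^ 2 * lf z +
       3 * const (polar A p q q) * lf x * lf y ^ 2 + 3 * const (polar A q q r) * lf y ^ 2 * lf z +
       3 * const (polar A p r r) * lf x * lf z ^ 2 + 3 * const (polar A q r r) * lf y * lf z ^ 2 +
       6 * const (polar A p q r) * lf x * lf y * lf z"
proof -
  obtain x y z where xyz: "br x y z \<noteq> 0"
    and v: "\<And>i. var i = const (p i) * lf x + const (q i) * lf y + const (r i) * lf z"
    using dual_basis[OF D] by blast
  define C where "C i j k = (const (A i j k) :: complex tpoly)" for i j k
  have C: "symmetric3 C" using A unfolding symmetric3_def C_def by metis
  have Cc: "polar C (\<lambda>i. const (u i)) (\<lambda>i. const (v i)) (\<lambda>i. const (w i)) = const (polar A u v w)" for u v w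
    unfolding C_def by (rule polar_const)
  have var: "var = (\<lambda>i. const (p i) * lf x + const (q i) * lf y + const (r i) * lf z)"
    using v by (intro ext)
  have sym: "polar A p q p = polar A p p q" "polar A q p p = polar A p p q"
    "polar A p r p = polar A p p r" "polar A r p p = polar A p p r"
    "polar A q p q = polar A p q q" "polar A q q p = polar A p q q"
    "polar A q r q = polar A q q r" "polar A r q q = polar A q q r"
    "polar A r p r = polar A p r r" "polar A r r p = polar A p r r"
    "polar A r q r = polar A q r r" "polar A r r q = polar A q r r"
    "polar A p r q = polar A p q r" "polar A q p r = polar A p q r" "polar A q r p = polar A p q r"
    "polar A r p q = polar A p q r" "polar A r q p = polar A p q r"
    using polar_swap12[OF A] polar_swap23[OF A] by metis+
  have "f = polar C var var var"
    unfolding f C_def by (rule refl)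
  also have "\<dots> = const (polar A p p p) * lf x ^ 3 + const (polar A q q q) * lf y ^ 3 + const (polar A r r r) * lf z ^ 3 +
       3 * const (polar A p p q) * lf x ^ 2 * lf y + 3 * const (polar A p p r) * lf x ^ 2 * lf z +
       3 * const (polar A p q q) * lf x * lf y ^ 2 + 3 * const (polar A q q r) * lf y ^ 2 * lf z +
       3 * const (polar A p r r) * lf x * lf z ^ 2 + 3 * const (polar A q r r) * lf y * lf z ^ 2 +
       6 * const (polar A p q r) * lf x * lf y * lf z"
    unfolding var polar_lincomb1 polar_lincomb2[OF C] polar_lincomb3[OF C] Cc sym by algebra
  finally show ?thesis using xyz that by blast
qed

text \<open>For fixed \<open>p\<close> the polar form is a 3x3 matrix whose determinant is a cubic
  form in \<open>p\<close>. This form has a zero on the line joining the first two unit vectors, and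
  a kernel vector there serves as \<open>q\<close>.\<close>

lemma exists_degenerate_polar:
  assumes A: "symmetric3 (A :: 3 \<Rightarrow> 3 \<Rightarrow> 3 \<Rightarrow> complex)"
  obtains p q where "p \<noteq> (\<lambda>_. 0)" "q \<noteq> (\<lambda>_. 0)" "\<And>w. polar A p q w = 0"
proof -
  define col where "col p j k = A 1 j k * p 1 + A 2 j k * p 2 + A 3 j k * p 3" for p :: "3 \<Rightarrow> complex" and j k
  have polar_col: "polar A p q w = comb (col p 1) (col p 2) (col p 3) q 1 * w 1 +
      comb (col p 1) (col p 2) (col p 3) q 2 * w 2 + comb (col p 1) (col p 2) (col p 3) q 3 * w 3" for p q w
    unfolding polar_def sum_3 comb_def col_def by algebra
  have "\<exists>p. p \<noteq> (\<lambda>_. 0) \<and> br (col p 1) (col p 2) (col p 3) = 0"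
  proof (cases "br (col (vec3 0 1 0) 1) (col (vec3 0 1 0) 2) (col (vec3 0 1 0) 3) = 0")
    case True
    moreover have "vec3 0 1 0 \<noteq> (\<lambda>_. 0)"
      by (metis vec3_simps(2) zero_neq_one)
    ultimately show ?thesis by blast
  next
    case False
    define u w where "u = col (vec3 1 0 0)" "w = col (vec3 0 1 0)"
    \<comment> \<open>The determinant at the point (1, t, 0) as a polynomial in t; its leading
      coefficient is the determinant at (0, 1, 0), nonzero in this case.\<close>
    define P where "P = [: br (u 1) (u 2) (u 3),
      br (w 1) (u 2) (u 3) + br (u 1) (w 2) (u 3) + br (u 1) (u 2) (w 3),
      br (u 1) (w 2) (w 3) + br (w 1) (u 2) (w 3) + br (w 1) (w 2) (u 3),
      br (w 1) (w 2) (w 3) :]"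
    have "degree P = 3"
      using False by (simp add: P_def u_w_def)
    then obtain t where "poly P t = 0"
      using fundamental_theorem_of_algebra[of P] by (auto simp: constant_degree)
    moreover have "col (vec3 1 t 0) j k = u j k + t * w j k" for j k
      by (simp add: u_w_def col_def algebra_simps)
    ultimately have "br (col (vec3 1 t 0) 1) (col (vec3 1 t 0) 2) (col (vec3 1 t 0) 3) = 0"
      by (simp add: br_def P_def algebra_simps)
    moreover have "vec3 1 t 0 \<noteq> (\<lambda>_. 0)"
      by (metis vec3_simps(1) zero_neq_one)
    ultimately show ?thesis by blast
  qed
  then obtain p where p: "p \<noteq> (\<lambda>_. 0)" "br (col p 1) (col p 2) (col p 3) = 0"
    by blast
  from p(2) obtain q where q: "q \<noteq> (\<lambda>_. 0)" "comb (col p 1) (col p 2) (col p 3) q = (\<lambda>_. 0)"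
    by (rule br_eq_0_imp_kernel)
  have "polar A p q w = 0" for w
    unfolding polar_col q(2) by simp
  with p(1) q(1) show ?thesis by (rule that)
qed

section \<open>Cubics with vanishing first invariant\<close>

lemma quadratic_zero:
  fixes a b c :: complex
  obtains s t where "s \<noteq> 0 \<or> t \<noteq> 0" "a * s ^ 2 + b * s * t + c * t ^ 2 = 0"
proof (cases "a = 0")
  case True
  then show ?thesis using that[of 1 0] by simp
next
  case False
  then have "degree [: c, b, a :] = 2" by simp
  then obtain s where "poly [: c, b, a :] s = 0"
    using fundamental_theorem_of_algebra[of "[: c, b, a :]"] by (auto simp: constant_degree)
  then show ?thesis
    using that[of s 1] by (simp add: algebra_simps power2_eq_square)
qed

lemma symmetric_2x2_kernel:
  fixes u h v :: complex
  assumes "u * v = h ^ 2"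
  obtains s t where "s \<noteq> 0 \<or> t \<noteq> 0" "u * s + h * t = 0" "h * s + v * t = 0"
proof (cases "u = 0")
  case True
  then have "h = 0" using assms by simp
  then show ?thesis using that[of 1 0] True by simp
next
  case False
  then show ?thesis
    using that[of "- h" u] assms by (simp add: power2_eq_square algebra_simps)
qed

lemma isotropic_basis:
  fixes u h v :: complex
  assumes "u * v \<noteq> h ^ 2"
  obtains k1 k2 k3 k4 where "k1 * k4 - k2 * k3 \<noteq> 0"
    "u * k1 ^ 2 + 2 * h * k1 * k2 + v * k2 ^ 2 = 0" "u * k3 ^ 2 + 2 * h * k3 * k4 + v * k4 ^ 2 = 0"
proof (cases "u = 0")
  case True
  \<comment> \<open>The isotropic vectors are (1, 0) and (v, -2h).\<close>
  then show ?thesis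
    using that[of 1 "- 2 * h" 0 v] assms by (simp add: power2_eq_square)
next
  case False
  define w where "w = csqrt (h ^ 2 - u * v)"
  have w: "w ^ 2 = h ^ 2 - u * v"
    by (simp add: w_def)
  then have "w \<noteq> 0" using assms by auto
  moreover have "(- h + w) * u - u * (- h - w) = 2 * w * u"
    by algebra
  ultimately have "(- h + w) * u - u * (- h - w) \<noteq> 0"
    using False by simp
  moreover have "u * (- h + w) ^ 2 + 2 * h * (- h + w) * u + v * u ^ 2 = 0"
    "u * (- h - w) ^ 2 + 2 * h * (- h - w) * u + v * u ^ 2 = 0"
    using w by algebra+
  ultimately show ?thesis by (rule that)
qed

text \<open>Either two polar directions are independent, which separates the variables, or the cubic has a square factor.\<close>

lemma binary_cubic_basis:
  fixes b e g c :: complex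
  obtains k1 k2 k3 k4 where "k1 * k4 - k2 * k3 \<noteq> 0"
    "b * k1 ^ 2 * k2 + e * (k1 ^ 2 * k4 + 2 * k1 * k2 * k3) + g * (2 * k1 * k3 * k4 + k2 * k3 ^ 2) + c * k3 ^ 2 * k4 = 0"
    "b * k1 * k2 ^ 2 + e * (2 * k1 * k2 * k4 + k2 ^ 2 * k3) + g * (k1 * k4 ^ 2 + 2 * k2 * k3 * k4) + c * k3 * k4 ^ 2 = 0
     \<or> b * k1 ^ 3 + 3 * e * k1 ^ 2 * k3 + 3 * g * k1 * k3 ^ 2 + c * k3 ^ 3 = 0"
proof -
  \<comment> \<open>The quadratic form is the Hessian of the binary cubic. At its zero (k1, k3) the
    polar is degenerate, and (k2, k4) is taken from its kernel.\<close>
  obtain k1 k3 where k: "k1 \<noteq> 0 \<or> k3 \<noteq> 0"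
    and "(b * g - e ^ 2) * k1 ^ 2 + (b * c - e * g) * k1 * k3 + (e * c - g ^ 2) * k3 ^ 2 = 0"
    by (rule quadratic_zero)
  then have "(b * k1 + e * k3) * (g * k1 + c * k3) = (e * k1 + g * k3) ^ 2"
    by algebra
  then obtain k2 k4 where k': "k2 \<noteq> 0 \<or> k4 \<noteq> 0"
    and m: "(b * k1 + e * k3) * k2 + (e * k1 + g * k3) * k4 = 0"
      "(e * k1 + g * k3) * k2 + (g * k1 + c * k3) * k4 = 0"
    by (rule symmetric_2x2_kernel)
  show ?thesis
  proof (cases "k1 * k4 - k2 * k3 = 0")
    case False
    moreover have "b * k1 ^ 2 * k2 + e * (k1 ^ 2 * k4 + 2 * k1 * k2 * k3) + g * (2 * k1 * k3 * k4 + k2 * k3 ^ 2) + c * k3 ^ 2 * k4 = 0"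
      using m by algebra
    moreover have "b * k1 * k2 ^ 2 + e * (2 * k1 * k2 * k4 + k2 ^ 2 * k3) + g * (k1 * k4 ^ 2 + 2 * k2 * k3 * k4) + c * k3 * k4 ^ 2 = 0"
      using m by algebra
    ultimately show ?thesis using that by blast
  next
    case True
    \<comment> \<open>Now (k1, k3) is itself in the kernel of its polar, hence a double zero of the
      cubic; any independent vector can complete the basis.\<close>
    have n: "(b * k1 + e * k3) * k1 + (e * k1 + g * k3) * k3 = 0"
      "(e * k1 + g * k3) * k1 + (g * k1 + c * k3) * k3 = 0"
    proof -
      have "((b * k1 + e * k3) * k1 + (e * k1 + g * k3) * k3) * k2 = 0"
        "((b * k1 + e * k3) * k1 + (e * k1 + g * k3) * k3) * k4 = 0"
        "((e * k1 + g * k3) * k1 + (g * k1 + c * k3) * k3) * k2 = 0"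
        "((e * k1 + g * k3) * k1 + (g * k1 + c * k3) * k3) * k4 = 0"
        using m True by algebra+
      with k' show "(b * k1 + e * k3) * k1 + (e * k1 + g * k3) * k3 = 0"
        "(e * k1 + g * k3) * k1 + (g * k1 + c * k3) * k3 = 0"
        by (metis mult_eq_0_iff)+
    qed
    obtain j2 j4 where "k1 * j4 - j2 * k3 \<noteq> 0"
    proof (cases "k1 = 0")
      case True
      then show ?thesis using that[of 0 1] that[of 1 0] k by auto
    next
      case False
      then show ?thesis using that[of 1 0] by auto
    qed
    moreover have "b * k1 ^ 2 * j2 + e * (k1 ^ 2 * j4 + 2 * k1 * j2 * k3) + g * (2 * k1 * k3 * j4 + j2 * k3 ^ 2) + c * k3 ^ 2 * j4 = 0"
      using n by algebra
    moreover have "b * k1 ^ 3 + 3 * e * k1 ^ 2 * k3 + 3 * g * k1 * k3 ^ 2 + c * k3 ^ 3 = 0"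
      using n by algebra
    ultimately show ?thesis using that by blast
  qed
qed

section \<open>Reduction to a sum of three cubes\<close>

definition is_fermat :: "complex tpoly \<Rightarrow> bool" where
  "is_fermat f \<longleftrightarrow> (\<exists>a b c. br a b c \<noteq> 0 \<and> f = lf a ^ 3 + lf b ^ 3 + lf c ^ 3)"

lemma is_fermat_diagonal:
  assumes "br x y z \<noteq> 0" "a \<noteq> 0" "b \<noteq> 0" "c \<noteq> 0"
  shows "is_fermat (const a * lf x ^ 3 + const b * lf y ^ 3 + const c * lf z ^ 3)"
proof -
  have root: "\<exists>s. s ^ 3 = a" for a :: complex
  proof -
    obtain s where "poly [:- a, 0, 0, 1:] s = 0"
      using fundamental_theorem_of_algebra[of "[:- a, 0, 0, 1:]"] by (auto simp: constant_degree)
    then show ?thesis by (intro exI[of _ s]) (simp add: power3_eq_cube mult.assoc)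
  qed
  obtain s t u where stu: "s ^ 3 = a" "t ^ 3 = b" "u ^ 3 = c" using root by metis
  then have "s \<noteq> 0" "t \<noteq> 0" "u \<noteq> 0" using assms by auto
  moreover have "br (\<lambda>i. s * x i) (\<lambda>i. t * y i) (\<lambda>i. u * z i) = s * t * u * br x y z"
    unfolding br_def by algebra
  moreover have "const a * lf x ^ 3 + const b * lf y ^ 3 + const c * lf z ^ 3 =
      lf (\<lambda>i. s * x i) ^ 3 + lf (\<lambda>i. t * y i) ^ 3 + lf (\<lambda>i. u * z i) ^ 3"
    by (simp add: lf_scale power_mult_distrib flip: const_power stu)
  ultimately show ?thesis
    unfolding is_fermat_def using assms(1) by (metis mult_eq_0_iff)
qed

text \<open>\<open>binary_cubic_basis\<close> either diagonalizes the part in y and z or leaves it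
  without its Y^3 and Y^2 Z terms. In the second case, and also when a diagonal coefficient is zero,
  \<open>f\<close> is a nullform after reordering the variables, contrary to T being
  nonzero.\<close>

lemma is_fermat_split_diagonal:
  assumes "br x y z \<noteq> 0" "a \<noteq> 0"
    and f: "f = split_cubic a 0 0 b e g c x y z" and T: "Aronhold_T f \<noteq> 0"
  shows "is_fermat f"
proof -
  obtain k1 k2 k3 k4 where k: "k1 * k4 - k2 * k3 \<noteq> 0"
    and e: "b * k1 ^ 2 * k2 + e * (k1 ^ 2 * k4 + 2 * k1 * k2 * k3) + g * (2 * k1 * k3 * k4 + k2 * k3 ^ 2) + c * k3 ^ 2 * k4 = 0"
    and gb: "b * k1 * k2 ^ 2 + e * (2 * k1 * k2 * k4 + k2 ^ 2 * k3) + g * (k1 * k4 ^ 2 + 2 * k2 * k3 * k4) + c * k3 * k4 ^ 2 = 0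
     \<or> b * k1 ^ 3 + 3 * e * k1 ^ 2 * k3 + 3 * g * k1 * k3 ^ 2 + c * k3 ^ 3 = 0"
    by (rule binary_cubic_basis)
  define d where "d = k1 * k4 - k2 * k3"
  \<comment> \<open>The inverse of the substitution with matrix entries \<open>k1\<close> to
    \<open>k4\<close>.\<close>
  define Y Z where "Y i = k4 / d * y i + - k2 / d * z i" and "Z i = - k3 / d * y i + k1 / d * z i" for i
  define b' e' g' c' where
    "b' = b * k1 ^ 3 + 3 * e * k1 ^ 2 * k3 + 3 * g * k1 * k3 ^ 2 + c * k3 ^ 3"
    "e' = b * k1 ^ 2 * k2 + e * (k1 ^ 2 * k4 + 2 * k1 * k2 * k3) + g * (2 * k1 * k3 * k4 + k2 * k3 ^ 2) + c * k3 ^ 2 * k4"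
    "g' = b * k1 * k2 ^ 2 + e * (2 * k1 * k2 * k4 + k2 ^ 2 * k3) + g * (k1 * k4 ^ 2 + 2 * k2 * k3 * k4) + c * k3 * k4 ^ 2"
    "c' = b * k2 ^ 3 + 3 * e * k2 ^ 2 * k4 + 3 * g * k2 * k4 ^ 2 + c * k4 ^ 3"
  have e': "e' = 0" using e by (simp add: b'_e'_g'_c'_def)
  have d: "d \<noteq> 0" using k by (simp add: d_def)
  have "y i = k1 * Y i + k2 * Z i" "z i = k3 * Y i + k4 * Z i" for i
  proof -
    have "(k1 * k4 - k2 * k3) / d = 1" using d by (simp add: d_def)
    then show "y i = k1 * Y i + k2 * Z i" "z i = k3 * Y i + k4 * Z i"
      unfolding Y_def Z_def divide_inverse by algebra+
  qed
  then have yz: "y = (\<lambda>i. k1 * Y i + k2 * Z i)" "z = (\<lambda>i. k3 * Y i + k4 * Z i)" by auto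
  have "br x y z = d * br x Y Z"
    unfolding yz d_def br_def by algebra
  then have br: "br x Y Z \<noteq> 0" using assms(1) by auto
  have "const b * lf y ^ 3 + 3 * const e * lf y ^ 2 * lf z + 3 * const g * lf y * lf z ^ 2 + const c * lf z ^ 3 =
      const b' * lf Y ^ 3 + 3 * const e' * lf Y ^ 2 * lf Z + 3 * const g' * lf Y * lf Z ^ 2 + const c' * lf Z ^ 3"
    unfolding yz lf_add lf_scale b'_e'_g'_c'_def const_hom const_numeral by algebra
  then have f': "f = const a * lf x ^ 3 + const b' * lf Y ^ 3 + 3 * const g' * lf Y * lf Z ^ 2 + const c' * lf Z ^ 3"
    using e' unfolding f split_cubic_def by (simp add: add.assoc)
  from gb have "g' = 0 \<or> b' = 0" by (simp add: b'_e'_g'_c'_def)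
  then show ?thesis
  proof
    assume g': "g' = 0"
    have "b' \<noteq> 0"
    proof
      assume "b' = 0"
      then have "f = split_cubic 0 0 0 a 0 0 c' Y x Z"
        unfolding f' g' split_cubic_def by simp
      with T show False by (simp add: Aronhold_T_nullform)
    qed
    moreover have "c' \<noteq> 0"
    proof
      assume "c' = 0"
      then have "f = split_cubic 0 0 0 a 0 0 b' Z x Y"
        unfolding f' g' split_cubic_def by simp
      with T show False by (simp add: Aronhold_T_nullform)
    qed
    ultimately show ?thesis
      using is_fermat_diagonal[OF br assms(2)] by (simp add: f' g')
  next
    assume "b' = 0"
    then have "f = split_cubic 0 0 g' a 0 0 c' Y x Z"
      unfolding f' split_cubic_def by simp
    with T show ?thesis by (simp add: Aronhold_T_nullform)
  qed
qed

text \<open>If \<open>a = 0\<close>, then also \<open>d = 0\<close> and \<open>f\<close> is a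
  nullform. Otherwise completing the cube, x' = x + (d/a) z, absorbs the mixed terms in x and z
  because h = d^2/a.\<close>

lemma is_fermat_split_degenerate:
  assumes br: "br x y z \<noteq> 0" and f: "f = split_cubic a d h b e g c x y z"
    and ah: "a * h = d ^ 2" and T: "Aronhold_T f \<noteq> 0"
  shows "is_fermat f"
proof (cases "a = 0")
  case True
  then have "d = 0" using ah by simp
  with True T show ?thesis by (simp add: f Aronhold_T_nullform)
next
  case False
  define x' where "x' i = x i + d / a * z i" for i
  have "br x' y z = br x y z"
    unfolding br_def x'_def by algebra
  moreover have "f = split_cubic a 0 0 b e g (c - d ^ 3 / a ^ 2) x' y z"
  proof -
    define k where "k = d / a"
    have d: "d = a * k" and h: "h = a * k ^ 2" and c: "d ^ 3 / a ^ 2 = a * k ^ 3"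
      using False ah by (simp_all add: k_def field_simps eval_nat_numeral)
    show ?thesis
      unfolding f c split_cubic_def x'_def k_def[symmetric] lf_add lf_scale
      unfolding d h const_hom const_0 by algebra
  qed
  ultimately show ?thesis
    using is_fermat_split_diagonal[of x' y z a f b e g] br False T by simp
qed

lemma is_fermat_split:
  assumes br: "br x y z \<noteq> 0" and f: "f = split_cubic a d h b e g c x y z"
    and S: "Aronhold_S f = 0" and T: "Aronhold_T f \<noteq> 0"
  shows "is_fermat f"
proof -
  have "a * h = d ^ 2 \<or> b * g = e ^ 2"
    using S br by (simp add: f Aronhold_S_split_cubic)
  then show ?thesis
  proof
    assume "b * g = e ^ 2"
    moreover have "br y x z \<noteq> 0" using br by (simp add: br_def algebra_simps)
    moreover have "f = split_cubic b e g a d h c y x z"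
      unfolding f split_cubic_def by (simp only: add_ac)
    ultimately show ?thesis using is_fermat_split_degenerate T by blast
  qed (use is_fermat_split_degenerate[OF br f] T in blast)
qed

lemma Aronhold_imp_is_fermat:
  assumes form: "is_form 3 f" and S: "Aronhold_S f = 0" and T: "Aronhold_T f \<noteq> 0"
  shows "is_fermat f"
proof -
  obtain A where A: "symmetric3 A" and f: "f = polar (\<lambda>i j k. const (A i j k)) var var var"
    using form by (rule is_form_3_polar)
  note sym = polar_swap12[OF A] polar_swap23[OF A]
  \<comment> \<open>Independent conjugate points \<open>p\<close>, \<open>q\<close> make the
    coefficients of x^2 y, x y^2 and xyz zero, leaving a split cubic.\<close>
  have case1: ?thesis if D: "br p q r \<noteq> 0" and pq: "\<And>w. polar A p q w = 0" for p q r
  proof -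
    have 0: "polar A p p q = 0" "polar A p q q = 0" "polar A p q r = 0"
      using pq sym by metis+
    obtain x y z where "br x y z \<noteq> 0" and
      "f = split_cubic (polar A p p p) (polar A p p r) (polar A p r r) (polar A q q q) (polar A q q r) (polar A q r r) (polar A r r r) x y z"
      by (rule polar_basis[OF A f D]) (simp add: 0 split_cubic_def)
    then show ?thesis using is_fermat_split S T by blast
  qed
  obtain p q where p: "p \<noteq> (\<lambda>_. 0)" and q: "q \<noteq> (\<lambda>_. 0)" and pq: "\<And>w. polar A p q w = 0"
    using exists_degenerate_polar[OF A] by blast
  consider (complement) r where "br p q r \<noteq> 0" | (dependent) k where "q = (\<lambda>i. k * p i)"
    using exists_complement[OF p, of q] by blast
  then show ?thesis
  proof cases
    case (complement r)
    then show ?thesis using case1 pq by blast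
  next
    case (dependent k)
    then have "k \<noteq> 0" using q by auto
    have lin: "polar A p (\<lambda>i. s * u i + t * v i) w = s * polar A p u w + t * polar A p v w" for s t u v w
      using polar_lincomb2[OF A, of p u s v t "\<lambda>_. 0" 0 w] by (simp add: mult.commute)
    \<comment> \<open>As \<open>q\<close> is a nonzero multiple of \<open>p\<close>, the point
      \<open>p\<close> is a singular point of the cubic.\<close>
    have pp: "polar A p p w = 0" for w
      using pq[of w] lin[of k p 0 p w] \<open>k \<noteq> 0\<close> unfolding dependent by simp
    obtain r1 r2 where r: "br p r1 r2 \<noteq> 0"
      using exists_basis_extension[OF p] by blast
    \<comment> \<open>The matrix of the tangent cone at \<open>p\<close>, in the directions
      \<open>r1\<close> and \<open>r2\<close>.\<close>
    define u h v where "u = polar A p r1 r1" "h = polar A p r1 r2" "v = polar A p r2 r2"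
    have uhv: "polar A p (\<lambda>i. s * r1 i + t * r2 i) r1 = u * s + h * t"
      "polar A p (\<lambda>i. s * r1 i + t * r2 i) r2 = h * s + v * t" for s t
      unfolding lin u_h_v_def sym(2)[of p r2 r1] by (simp_all only: mult.commute)
    \<comment> \<open>By \<open>pp\<close>, conjugacy to \<open>p\<close> need only be tested on two
      vectors completing \<open>p\<close> to a basis; the coordinates of \<open>w\<close> come from
      Cramer's rule.\<close>
    have vanish: "polar A p q w = 0"
      if D: "br p a b \<noteq> 0" and 0: "polar A p q a = 0" "polar A p q b = 0" for q a b w
    proof -
      define x y z where "x = br w a b / br p a b" "y = br p w b / br p a b" "z = br p a w / br p a b"
      have "w 1 * br p a b = p 1 * br w a b + a 1 * br p w b + b 1 * br p a w"
        "w 2 * br p a b = p 2 * br w a b + a 2 * br p w b + b 2 * br p a w"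
        "w 3 * br p a b = p 3 * br w a b + a 3 * br p w b + b 3 * br p a w"
        unfolding br_def by algebra+
      then have "w i * br p a b = p i * br w a b + a i * br p w b + b i * br p a w" for i
        using exhaust_3[of i] by (elim disjE) simp_all
      then have "w i = p i * x + a i * y + b i * z" for i
        using D unfolding x_y_z_def by (simp add: field_simps)
      then have "w = (\<lambda>i. p i * x + a i * y + b i * z)" by (intro ext)
      then have "polar A p q w = x * polar A p q p + y * polar A p q a + z * polar A p q b"
        using polar_lincomb3[OF A] by simp
      moreover have "polar A p q p = 0"
        using sym(2)[of p q p] pp by simp
      ultimately show ?thesis using 0 by simp
    qed
    show ?thesis
    proof (cases "u * v = h ^ 2")
      case True
      \<comment> \<open>For a degenerate tangent cone, a kernel direction is conjugate to
        \<open>p\<close> and independent of it, so \<open>case1\<close> applies.\<close>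
      then obtain s t where st: "s \<noteq> 0 \<or> t \<noteq> 0" "u * s + h * t = 0" "h * s + v * t = 0"
        by (rule symmetric_2x2_kernel)
      let ?q = "\<lambda>i. s * r1 i + t * r2 i"
      have "polar A p ?q w = 0" for w
        by (rule vanish[OF r]) (use st uhv in simp_all)
      moreover have "br p ?q r2 = s * br p r1 r2" "br p ?q r1 = - t * br p r1 r2"
        unfolding br_def by algebra+
      then have "br p ?q r2 \<noteq> 0 \<or> br p ?q r1 \<noteq> 0"
        using st(1) r by simp
      ultimately show ?thesis using case1 by blast
    next
      case False
      \<comment> \<open>Two isotropic directions of the tangent cone as basis vectors remove the
        terms x y^2 and x z^2.\<close>
      obtain k1 k2 k3 k4 where k: "k1 * k4 - k2 * k3 \<noteq> 0"
        "u * k1 ^ 2 + 2 * h * k1 * k2 + v * k2 ^ 2 = 0" "u * k3 ^ 2 + 2 * h * k3 * k4 + v * k4 ^ 2 = 0"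
        by (rule isotropic_basis[OF False])
      define g2 g3 where "g2 = (\<lambda>i. k1 * r1 i + k2 * r2 i)" "g3 = (\<lambda>i. k3 * r1 i + k4 * r2 i)"
      have "br p g2 g3 = (k1 * k4 - k2 * k3) * br p r1 r2"
        unfolding br_def g2_g3_def by algebra
      then have D: "br p g2 g3 \<noteq> 0" using k(1) r by simp
      have iso: "polar A p (\<lambda>i. s * r1 i + t * r2 i) (\<lambda>i. s * r1 i + t * r2 i) = u * s ^ 2 + 2 * h * s * t + v * t ^ 2" for s t
      proof -
        let ?q = "\<lambda>i. s * r1 i + t * r2 i"
        have "polar A p ?q ?q = s * polar A p ?q r1 + t * polar A p ?q r2"
          unfolding lin[of s r1 t r2 ?q] by (simp only: sym(2)[of p r1 ?q] sym(2)[of p r2 ?q])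
        also have "\<dots> = u * s ^ 2 + 2 * h * s * t + v * t ^ 2"
          unfolding uhv by algebra
        finally show ?thesis .
      qed
      have 22: "polar A p g2 g2 = 0" and 33: "polar A p g3 g3 = 0"
        using k(2,3) by (simp_all add: g2_g3_def iso)
      show ?thesis
      proof (cases "polar A p g2 g3 = 0")
        case True
        then have "polar A p g2 w = 0" for w
          using vanish[OF D 22] by blast
        then show ?thesis using case1 D by blast
      next
        case False
        define m where "m = polar A p g2 g3"
        obtain x y z b c e g where D': "br x y z \<noteq> 0" and
          f': "f = const b * lf y ^ 3 + const c * lf z ^ 3 + 3 * const e * lf y ^ 2 * lf z +
             3 * const g * lf y * lf z ^ 2 + 6 * const m * lf x * lf y * lf z"
          by (rule polar_basis[OF A f D]) (simp add: pp 22 33 m_def)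
        \<comment> \<open>The shift is chosen so that 6m x' y z absorbs 3e y^2 z + 3g y z^2.\<close>
        define x' where "x' i = x i + (e / (2 * m) * y i + g / (2 * m) * z i)" for i
        have "br x' y z = br x y z"
          unfolding br_def x'_def by algebra
        moreover have "f = const b * lf y ^ 3 + const c * lf z ^ 3 + 6 * const m * lf x' * lf y * lf z"
        proof -
          have "const e = (2 * const m * const (e / (2 * m)) :: complex tpoly)"
            "const g = (2 * const m * const (g / (2 * m)) :: complex tpoly)"
            using False by (simp_all add: m_def flip: const_mult const_numeral)
          then show ?thesis
            unfolding f' x'_def lf_add lf_scale by algebra
        qed
        ultimately have "Aronhold_S f = - 216 * br x y z ^ 4 * m ^ 4"
          using Aronhold_S_nodal by simp
        then have False using S D' \<open>polar A p g2 g3 \<noteq> 0\<close> by (simp add: m_def)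
        then show ?thesis ..
      qed
    qed
  qed
qed

text \<open>The given cubes bound the rank from above. Any shorter representation is a
  \<open>csum\<close> of fewer than three cubes, for which T vanishes.\<close>

lemma waring_rank_fermat:
  assumes f: "f = lf a ^ 3 + lf b ^ 3 + lf c ^ 3" and T: "Aronhold_T f \<noteq> 0"
  shows "waring_rank 3 f = 3"
  unfolding waring_rank_def
proof (rule Least_equality)
  show "\<exists>l :: nat \<Rightarrow> complex tpoly. (\<forall>i<3. is_form 1 (l i)) \<and> f = (\<Sum>i<3. l i ^ 3)"
    by (rule exI[of _ "\<lambda>i. if i = 0 then lf a else if i = 1 then lf b else lf c"])
      (simp add: f sum_lessThan_3 is_form_1_lf del: One_nat_def)
next
  fix r
  assume "\<exists>l :: nat \<Rightarrow> complex tpoly. (\<forall>i<r. is_form 1 (l i)) \<and> f = (\<Sum>i<r. l i ^ 3)"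
  then obtain l :: "nat \<Rightarrow> complex tpoly" where l: "\<And>i. i < r \<Longrightarrow> is_form 1 (l i)" "f = (\<Sum>i<r. l i ^ 3)"
    by blast
  then have "\<forall>i. \<exists>w. i < r \<longrightarrow> l i = lf w"
    by (metis is_form_1_imp_lf)
  then obtain v where v: "\<And>i. i < r \<Longrightarrow> l i = lf (v i)"
    by metis
  have "f = csum {..<r} (\<lambda>_. 1) v"
    by (simp add: l(2) csum_def v)
  then show "3 \<le> r"
    using Aronhold_T_csum_lt_3[of r] T by (metis not_le)
qed

theorem lemma5p14:
  fixes f :: "complex tpoly"
  assumes "is_form 3 f"
  shows "((Aronhold_S f = 0 \<and> Aronhold_T f \<noteq> 0) \<longleftrightarrow>
          (\<exists>a b c :: complex tpoly. is_form 1 a \<and> is_form 1 b \<and> is_form 1 c \<and>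
             distinct [a, b, c] \<and> tpoly.independent {a, b, c} \<and>
             f = a ^ 3 + b ^ 3 + c ^ 3)) \<and>
         (Aronhold_S f = 0 \<and> Aronhold_T f \<noteq> 0 \<longrightarrow> waring_rank 3 f = 3)"
proof (intro conjI iffI impI)
  assume ST: "Aronhold_S f = 0 \<and> Aronhold_T f \<noteq> 0"
  then obtain a b c where D: "br a b c \<noteq> 0" and f: "f = lf a ^ 3 + lf b ^ 3 + lf c ^ 3"
    using Aronhold_imp_is_fermat[OF assms] by (auto simp: is_fermat_def)
  show "\<exists>a b c :: complex tpoly. is_form 1 a \<and> is_form 1 b \<and> is_form 1 c \<and>
      distinct [a, b, c] \<and> tpoly.independent {a, b, c} \<and> f = a ^ 3 + b ^ 3 + c ^ 3"
    using D f is_form_1_lf distinct_independent_iff_br by blast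
  show "waring_rank 3 f = 3"
    using waring_rank_fermat f ST by blast
next
  assume "\<exists>a b c :: complex tpoly. is_form 1 a \<and> is_form 1 b \<and> is_form 1 c \<and>
      distinct [a, b, c] \<and> tpoly.independent {a, b, c} \<and> f = a ^ 3 + b ^ 3 + c ^ 3"
  then obtain a b c where *: "distinct [lf a, lf b, lf c] \<and> tpoly.independent {lf a, lf b, lf c}"
    and f: "f = lf a ^ 3 + lf b ^ 3 + lf c ^ 3"
    by (metis is_form_1_imp_lf)
  show "Aronhold_S f = 0"
    by (simp add: f Aronhold_S_fermat)
  show "Aronhold_T f \<noteq> 0"
    using * unfolding distinct_independent_iff_br by (simp add: f Aronhold_T_fermat)
qed

end
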